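(* Let $X$ be a $G$-valued discrete cocycle, where $G$ is one of $GL(n,\mathbb{R})$, $SL(n,\mathbb{R})$, $Sp(n,\mathbb{R})$, $O(n)$ or $U(n)$, and assume $X$ is $GL(n,\mathbb{C})$-reducible. Then $X$ is $G$-reducible modulo $\chi_G$, where $\chi_G=2$ if $G=GL(n,\mathbb{R})$, $SL(n,\mathbb{R})$, $Sp(n,\mathbb{R})$ or $O(n)$, and $\chi_G=1$ if $G=U(n)$.
   Context: Let $\mathbb{T}^d=\mathbb{R}^d/\mathbb{Z}^d$ and, for an integer $N\ge 1$, $N\mathbb{T}^d=\mathbb{R}^d/(N\mathbb{Z})^d$; functions on $\mathbb{T}^d$ are also viewed as functions on $N\mathbb{T}^d$ through the canonical projection. Fix $\omega\in\mathbb{R}^d$ such that $(\omega,1)\in\mathbb{R}^{d+1}$ is rationally independent, i.e. $\langle k,(\omega,1)\rangle\ne0$ for all $k\in\mathbb{Z}^{d+1}\setminus\{0\}$. A discrete $G$-valued cocycle is a map $X:\mathbb{Z}\times\mathbb{T}^d\to G$, $(m,\theta)\mapsto X^m(\theta)$, such that $X^{m+m'}(\theta)=X^{m}(\theta+m'\omega)X^{m'}(\theta)$ for all $m,m'\in\mathbb{Z}$, $\theta\in\mathbb{T}^d$. A discrete cocycle $X$ is $G$-reducible modulo $N$ if there exist a continuous $Z:N\mathbb{T}^d\to G$ and $A\in G$ such that $X^m(\theta)=Z(\theta+m\omega)^{-1}A^mZ(\theta)$ for all $m\in\mathbb{Z}$ and all $\theta$ (in $N\mathbb{T}^d$). "$G$-reducible"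 means $G$-reducible modulo $1$. For $n$ even, $Sp(n,\mathbb{R})$ is the group of real $n\times n$ matrices $M$ with $M^*JM=J$, where $M^*$ is the transpose and $J=\begin{pmatrix}0&-I_{n/2}\\ I_{n/2}&0\end{pmatrix}$ (so $n$ is assumed even when $G=Sp(n,\mathbb{R})$). *)

theory Defs
  imports "HOL-Analysis.Analysis"
begin

subsection \<open>Matrix groups\<close>

text \<open>All groups are subsets of the complex square matrices; the real groups are embedded
  entrywise, so that a cocycle in any of them is also a cocycle in the complex general linear
  group.\<close>

abbreviation complexify :: "real^'n^'n \<Rightarrow> complex^'n^'n" where
  "complexify \<equiv> map_matrix complex_of_real"

definition GL_complex :: "(complex^'n^'n) set" where
  "GL_complex = {M. invertible M}"

definition GL_real :: "(complex^'n^'n) set" where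
  "GL_real = complexify ` {M. invertible M}"

definition SL_real :: "(complex^'n^'n) set" where
  "SL_real = complexify ` {M. det M = 1}"

definition O_real :: "(complex^'n^'n) set" where
  "O_real = complexify ` {M. orthogonal_matrix M}"

definition U_complex :: "(complex^'n^'n) set" where
  "U_complex = {M. map_matrix cnj (transpose M) ** M = mat 1}"

text \<open>Square matrices of even size \<open>n\<close> are indexed by \<open>'m + 'm\<close> with \<open>CARD('m) = n / 2\<close>; the
  indices \<open>Inl\<close> and \<open>Inr\<close> are the first and the second block, so \<open>J_symp\<close> has the blocks \<open>0\<close>,
  \<open>-I\<close> (upper row) and \<open>I\<close>, \<open>0\<close> (lower row).\<close>

definition J_symp :: "real^('m::finite + 'm)^('m + 'm)" where
  "J_symp = (\<chi> i j. case (i, j) of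
      (Inl a, Inr b) \<Rightarrow> (if a = b then -1 else 0)
    | (Inr a, Inl b) \<Rightarrow> (if a = b then 1 else 0)
    | _ \<Rightarrow> 0)"

definition Sp_real :: "(complex^('m::finite + 'm)^('m + 'm)) set" where
  "Sp_real = complexify ` {M. transpose M ** J_symp ** M = J_symp}"

text \<open>The operations \<open>*\<close> and \<open>^\<close> act componentwise on the type of matrices, so powers with
  respect to \<open>**\<close> have to be defined. For negative exponents this is meaningful for invertible
  matrices only.\<close>

definition matrix_zpow :: "'a::semiring_1^'n^'n \<Rightarrow> int \<Rightarrow> 'a^'n^'n" where
  "matrix_zpow A m =
     (if m \<ge> 0 then (((**) A) ^^ nat m) (mat 1)
      else (((**) (matrix_inv A)) ^^ nat (- m)) (mat 1))"

subsection \<open>Cocycles over a translation of the torus\<close>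

definition integer_vectors :: "(real^'d) set" where
  "integer_vectors = {k. \<forall>i. k $ i \<in> \<int>}"

text \<open>The pair \<open>(\<omega>, 1)\<close> lives in the inner product space \<open>real^'d \<times> real\<close>.\<close>

definition rationally_independent :: "real^'d \<Rightarrow> bool" where
  "rationally_independent \<omega> \<longleftrightarrow>
     (\<forall>k \<in> integer_vectors \<times> \<int>. k \<noteq> 0 \<longrightarrow> k \<bullet> (\<omega>, 1 :: real) \<noteq> 0)"

text \<open>A function on the torus of side length \<open>N\<close>, the quotient of \<open>real^'d\<close> by \<open>N\<close> times the
  integer vectors, is given by its lift to \<open>real^'d\<close>, which is an arbitrary function periodic with
  respect to that lattice. By the universal property of the quotient topology the function is
  continuous iff its lift is, and viewing a function on the torus of side length 1 as a function on
  the torus of side length \<open>N\<close> does not change the lift.\<close>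

definition torus_periodic :: "nat \<Rightarrow> (real^'d \<Rightarrow> 'b) \<Rightarrow> bool" where
  "torus_periodic N f \<longleftrightarrow> (\<forall>\<theta>. \<forall>k \<in> integer_vectors. f (\<theta> + real N *\<^sub>R k) = f \<theta>)"

definition discrete_cocycle ::
    "real^'d \<Rightarrow> (complex^'n^'n) set \<Rightarrow> (int \<Rightarrow> real^'d \<Rightarrow> complex^'n^'n) \<Rightarrow> bool" where
  "discrete_cocycle \<omega> G X \<longleftrightarrow>
     (\<forall>m. torus_periodic 1 (X m)) \<and>
     (\<forall>m \<theta>. X m \<theta> \<in> G) \<and>
     (\<forall>m m' \<theta>. X (m + m') \<theta> = X m (\<theta> + of_int m' *\<^sub>R \<omega>) ** X m' \<theta>)"

definition reducible_mod ::
    "nat \<Rightarrow> real^'d \<Rightarrow> (complex^'n^'n) set \<Rightarrow> (int \<Rightarrow> real^'d \<Rightarrow> complex^'n^'n) \<Rightarrow> bool" where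
  "reducible_mod N \<omega> G X \<longleftrightarrow>
     (\<exists>Z A. continuous_on UNIV Z \<and> torus_periodic N Z \<and> (\<forall>\<theta>. Z \<theta> \<in> G) \<and> A \<in> G \<and>
        (\<forall>m \<theta>. X m \<theta> = matrix_inv (Z (\<theta> + of_int m *\<^sub>R \<omega>)) ** matrix_zpow A m ** Z \<theta>))"

abbreviation reducible ::
    "real^'d \<Rightarrow> (complex^'n^'n) set \<Rightarrow> (int \<Rightarrow> real^'d \<Rightarrow> complex^'n^'n) \<Rightarrow> bool" where
  "reducible \<equiv> reducible_mod 1"

end

theory Submission
  imports
    Defs
    "HOL-Computational_Algebra.Fundamental_Theorem_Algebra"
    "HOL-Computational_Algebra.Polynomial_Factorial"
    "HOL-Computational_Algebra.Field_as_Ring"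
begin

text \<open>Reducibility provides a continuous periodic family \<open>Z\<close> of complex invertible matrices with
  \<open>Z (\<theta> + \<omega>) X(\<theta>) = A Z \<theta>\<close>, where \<open>X\<close> is the generator \<open>X 1\<close> of the cocycle and \<open>A\<close> is constant.
  The problem is to move \<open>Z\<close> into the group. Except for the special linear group, each group is the set
  of fixed points in the complex general linear group of one or two multiplicative maps \<open>\<tau>\<close>: complex
  conjugation, the duality \<open>M \<mapsto> F\<^sup>-\<^sup>1 M\<^sup>-\<^sup>T F\<close> for a bilinear form \<open>F\<close>, or the composite of the two. If
  \<open>\<tau>\<close> fixes \<open>X\<close>, then \<open>W = Z \<tau>(Z)\<^sup>-\<^sup>1\<close> satisfies \<open>W (\<theta> + \<omega>) \<tau>(A) = A W \<theta>\<close>. Should \<open>W\<close> happen to be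
  constant, then \<open>\<tau>\<close> fixes \<open>Y \<theta> = Z(0)\<^sup>-\<^sup>1 Z \<theta>\<close>, for every such \<open>\<tau>\<close> at once, and \<open>Y\<close> conjugates the
  cocycle to a constant one inside the group.

  The obstruction to constancy is resonance. Cut \<open>W\<close> into blocks by the spectral projections of
  \<open>A\<close> and \<open>\<tau>(A)\<close>. On the block of the eigenvalues \<open>a\<close> and \<open>b\<close>, translation by \<open>\<omega>\<close> acts as \<open>a / b\<close> plus a
  nilpotent map; boundedness kills the nilpotent part
  (\<open>shift_semisimple\<close>, \<open>shift_generalized_eigenmatrix\<close>), and by the density of the orbits of the
  translation every entry is a multiple of a character \<open>e(k \<cdot> \<theta>)\<close>, where
  \<open>e(x) = exp(2\<pi>\<i>x)\<close> and \<open>a = e(k \<cdot> \<omega>) b\<close>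
  (\<open>shift_eigenfunction_is_character\<close>). To make these characters trivial, choose a function \<open>\<rho>\<close> on
  the eigenvalues with \<open>\<rho> (e(k \<cdot> \<omega>) a) = \<rho> a + k\<close> and replace \<open>Z\<close> by \<open>K(-\<theta>) Z \<theta>\<close>, where
  \<open>K(\<theta>) = \<Sum> e(\<rho>(a) \<cdot> \<theta>) P\<^sub>a\<close> is built from the spectral projections \<open>P\<^sub>a\<close> of \<open>A\<close>. This turns \<open>W\<close> into a
  constant (\<open>gauge_trivializes\<close>), provided that \<open>\<tau>\<close> sends the gauge \<open>K\<close> of \<open>A\<close> to the gauge of \<open>\<tau>(A)\<close>.

  That proviso decides the covering degree. Conjugation and duality send \<open>a\<close> to the conjugate of \<open>a\<close>
  and to \<open>1 / a\<close>, and both require \<open>\<rho>\<close> to change sign. If \<open>a\<close> equals \<open>e(k \<cdot> \<omega>)\<close> times its conjugate,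
  this forces \<open>\<rho> a = k / 2\<close>, so \<open>\<rho>\<close> takes half-integer values and \<open>K\<close> lives on the torus of side
  length 2 (\<open>ex_half_resonance_index\<close>). For the unitary group \<open>\<tau>\<close> sends \<open>a\<close> to the positive multiple
  \<open>a / \<bar>a\<bar>\<^sup>2\<close> of itself, an integer-valued \<open>\<rho>\<close> is compatible with that, and no covering occurs.
  In the special linear case the determinant of \<open>Y\<close> is real-valued and, on the torus of side length 2, a multiple of a character;
  hence it equals its value 1 at the origin (\<open>real_shift_eigenfunction_constant\<close>).\<close>

section \<open>Characters of the torus and translation-equivariant functions\<close>

definition character :: "real^'d \<Rightarrow> real^'d \<Rightarrow> complex" where
  "character k \<theta> = cis (2 * pi * (k \<bullet> \<theta>))"

lemma character_add: "character k (\<theta> + \<eta>) = character k \<theta> * character k \<eta>"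
  by (simp add: character_def inner_add_right cis_mult distrib_left)

lemma character_add_left: "character (k + l) \<theta> = character k \<theta> * character l \<theta>"
  by (simp add: character_def inner_add_left cis_mult distrib_left)

lemma character_0 [simp]: "character k 0 = 1" "character 0 \<theta> = 1"
  by (simp_all add: character_def)

lemma norm_character [simp]: "norm (character k \<theta>) = 1"
  by (simp add: character_def)

lemma character_nonzero [simp]: "character k \<theta> \<noteq> 0"
  by (metis norm_character norm_zero zero_neq_one)

lemma cnj_character: "cnj (character k \<theta>) = character (- k) \<theta>"
  by (simp add: character_def cis_cnj)

lemma character_minus: "character k (- \<theta>) = character (- k) \<theta>"
  by (simp add: character_def)

lemma character_uminus_left: "character (- k) \<theta> = inverse (character k \<theta>)"
  by (simp add: character_def flip: cis_inverse)

lemma continuous_on_character [continuous_intros]: "continuous_on S (character k)"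
  unfolding character_def cis_conv_exp by (intro continuous_intros)

lemma integer_vectors_add: "k \<in> integer_vectors \<Longrightarrow> l \<in> integer_vectors \<Longrightarrow> k + l \<in> integer_vectors"
  and integer_vectors_diff: "k \<in> integer_vectors \<Longrightarrow> l \<in> integer_vectors \<Longrightarrow> k - l \<in> integer_vectors"
  and integer_vectors_minus: "k \<in> integer_vectors \<Longrightarrow> - k \<in> integer_vectors"
  by (auto simp: integer_vectors_def)

lemma inner_integer_vectors: "k \<in> integer_vectors \<Longrightarrow> l \<in> integer_vectors \<Longrightarrow> k \<bullet> l \<in> \<int>"
  unfolding inner_vec_def integer_vectors_def inner_real_def by (intro Ints_sum Ints_mult) auto

lemma character_integer_vectors:
  assumes "k \<in> integer_vectors" "l \<in> integer_vectors"
  shows "character k l = 1"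
proof -
  obtain n where "k \<bullet> l = of_int n"
    using inner_integer_vectors[OF assms] by (auto elim: Ints_cases)
  then show ?thesis by (simp add: character_def cis_multiple_2pi)
qed

lemma character_eq_1_imp_0:
  assumes "rationally_independent \<omega>" "k \<in> integer_vectors" "character k \<omega> = 1"
  shows "k = 0"
proof (rule ccontr)
  assume "k \<noteq> 0"
  have "cos (2 * pi * (k \<bullet> \<omega>)) = 1"
    using assms(3) unfolding character_def by (metis cis.sel(1) one_complex.sel(1))
  then obtain n :: int where "2 * pi * (k \<bullet> \<omega>) = of_int n * 2 * pi"
    using cos_one_2pi_int by blast
  then have "k \<bullet> \<omega> = of_int n" by simp
  then have "(k, - of_int n) \<bullet> (\<omega>, 1 :: real) = 0" by simp
  moreover have "(k, - of_int n :: real) \<in> integer_vectors \<times> \<int>" "(k, - of_int n :: real) \<noteq> 0"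
    using assms(2) \<open>k \<noteq> 0\<close> by (auto simp: zero_prod_def)
  ultimately show False
    using assms(1) unfolding rationally_independent_def by blast
qed

text \<open>This is Kronecker's approximation theorem; the numbers \<open>\<omega>\<^sub>i\<close> together with 1 are enumerated by
  natural numbers because the theorem is stated for sequences of reals.\<close>

lemma orbit_dense:
  fixes \<omega> \<eta> :: "real^'d"
  assumes "rationally_independent \<omega>" "e > 0"
  obtains m :: int and k where "k \<in> integer_vectors" "dist (of_int m *\<^sub>R \<omega> + k) \<eta> < e"
proof -
  define n where "n = CARD('d)"
  obtain b :: "nat \<Rightarrow> 'd" where b: "bij_betw b {..<n} UNIV"
    using ex_bij_betw_nat_finite[of "UNIV :: 'd set"] by (auto simp: n_def atLeast0LessThan)
  have npos: "n > 0" by (simp add: n_def)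
  \<comment> \<open>The last term of the sequence is the number 1 required by Kronecker's theorem.\<close>
  define t where "t i = (if i < n then \<omega> $ b i else 1)" for i
  interpret Z: Modules.module "(\<lambda>r. (*) (real_of_int r))"
    by (simp add: Modules.module.intro distrib_left mult.commute)
  have rel: "\<forall>i\<le>n. c i = 0" if "(\<Sum>i\<le>n. of_int (c i) * t i) = 0" for c :: "nat \<Rightarrow> int"
  proof -
    define k :: "real^'d" where "k = (\<chi> j. of_int (c (the_inv_into {..<n} b j)))"
    have kb: "k $ b i = of_int (c i)" if "i < n" for i
      using b that by (simp add: k_def the_inv_into_f_f bij_betw_def)
    have "k \<bullet> \<omega> = (\<Sum>j\<in>UNIV. k $ j * \<omega> $ j)" by (simp add: inner_vec_def)
    also have "\<dots> = (\<Sum>i<n. of_int (c i) * t i)"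
      using kb by (subst sum.reindex_bij_betw[OF b, symmetric]) (simp add: t_def)
    finally have "(k, of_int (c n)) \<bullet> (\<omega>, 1 :: real) = (\<Sum>i<Suc n. of_int (c i) * t i)"
      by (simp add: t_def)
    then have "(k, of_int (c n)) \<bullet> (\<omega>, 1 :: real) = 0"
      using that by (simp add: lessThan_Suc_atMost)
    moreover have "(k, of_int (c n) :: real) \<in> integer_vectors \<times> \<int>"
      by (simp add: integer_vectors_def k_def)
    ultimately have "k = 0" "of_int (c n) = (0::real)"
      using assms(1) unfolding rationally_independent_def by (metis prod.inject zero_prod_def)+
    then show ?thesis using kb
      by (metis le_neq_implies_less of_int_0_eq_iff of_int_eq_0_iff zero_index)
  qed
  have inj: "inj_on t {..n}"
  proof (rule inj_onI, rule ccontr)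
    fix i j assume ij: "i \<in> {..n}" "j \<in> {..n}" "t i = t j" "i \<noteq> j"
    have "(\<Sum>l\<le>n. of_int ((if l = i then 1 else 0) - (if l = j then 1 else 0)) * t l) =
          (\<Sum>l\<le>n. (if l = i then t l else 0)) - (\<Sum>l\<le>n. (if l = j then t l else 0))"
      unfolding sum_subtractf[symmetric] by (intro sum.cong) auto
    also have "\<dots> = 0" using ij by simp
    finally have "(if i = i then 1 else 0) - (if i = j then 1 else 0) = (0::int)"
      using rel ij(1) by fastforce
    then show False using ij by simp
  qed
  have indep: "Z.independent (t ` {..n})"
  proof
    assume "Z.dependent (t ` {..n})"
    then obtain f x where f: "(\<Sum>x\<in>t ` {..n}. real_of_int (f x) * x) = 0"
      and x: "x \<in> {..n}" "f (t x) \<noteq> 0"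
      using Z.dependent_finite[of "t ` {..n}"] by auto
    have "(\<Sum>i\<le>n. of_int (f (t i)) * t i) = 0"
      using f by (simp add: sum.reindex[OF inj])
    then show False using rel[of "\<lambda>i. f (t i)"] x by auto
  qed
  have "e / (2 * n) > 0" using assms(2) npos by simp
  from Kronecker_thm_2[OF indep inj _ this, of "\<lambda>i. \<eta> $ b i"]
  obtain m h where mh: "\<And>i. i < n \<Longrightarrow> \<bar>of_int m * t i - of_int (h i) - \<eta> $ b i\<bar> < e / (2 * n)"
    by (auto simp: t_def)
  define k :: "real^'d" where "k = (\<chi> j. - of_int (h (the_inv_into {..<n} b j)))"
  have small: "\<bar>(of_int m *\<^sub>R \<omega> + k - \<eta>) $ j\<bar> < e / (2 * n)" for j
  proof -
    obtain i where i: "i < n" "j = b i" using b by (metis UNIV_I bij_betw_iff_bijections lessThan_iff)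
    then have "the_inv_into {..<n} b j = i" using b by (simp add: the_inv_into_f_f bij_betw_def)
    then show ?thesis using mh[OF i(1)] i by (simp add: k_def t_def algebra_simps)
  qed
  have "norm (of_int m *\<^sub>R \<omega> + k - \<eta>) \<le> (\<Sum>j\<in>UNIV. \<bar>(of_int m *\<^sub>R \<omega> + k - \<eta>) $ j\<bar>)"
    by (rule norm_le_l1_cart)
  also have "\<dots> \<le> (\<Sum>j\<in>(UNIV::'d set). e / (2 * n))"
    using small by (intro sum_mono less_imp_le) auto
  also have "\<dots> < e" using assms(2) npos by (simp add: n_def)
  finally have "dist (of_int m *\<^sub>R \<omega> + k) \<eta> < e" by (simp add: dist_norm)
  moreover have "k \<in> integer_vectors" by (simp add: k_def integer_vectors_def)
  ultimately show ?thesis using that by blast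
qed

text \<open>The defect \<open>r \<mapsto> g (r x) - r g x\<close> is additive and vanishes at the integers, so its continuity on
  \<open>[0, 1]\<close> makes it bounded, and a bounded additive function is zero.\<close>

lemma continuous_additive_scaleR:
  fixes g :: "'a::real_normed_vector \<Rightarrow> 'b::real_normed_vector"
  assumes cont: "continuous_on UNIV g" and add: "\<And>x y. g (x + y) = g x + g y"
  shows "g (r *\<^sub>R x) = r *\<^sub>R g x"
proof -
  define h where "h r = g (r *\<^sub>R x) - r *\<^sub>R g x" for r
  have h_add: "h (r + s) = h r + h s" for r s
    by (simp add: h_def add scaleR_left_distrib)
  have h0: "h 0 = 0" using h_add[of 0 0] by simp
  have h1: "h 1 = 0" by (simp add: h_def)
  have h_nat: "h (real n * r) = real n *\<^sub>R h r" for n r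
    by (induction n) (simp_all add: h0 h_add algebra_simps)
  have h_neg: "h (- r) = - h r" for r
    using h_add[of r "- r"] h0 by (simp add: eq_neg_iff_add_eq_0 add.commute)
  have h_int: "h (of_int m) = 0" for m
    using h_nat[of "nat m" 1] h_nat[of "nat (- m)" 1] h_neg[of "of_int m"] h1 by (cases "m \<ge> 0") auto
  have "continuous_on UNIV h"
    unfolding h_def by (intro continuous_intros continuous_on_compose2[OF cont]) auto
  then have "compact (h ` {0..1})"
    by (intro compact_continuous_image) (auto intro: continuous_on_subset)
  then obtain M where M: "\<And>s. s \<in> {0..1} \<Longrightarrow> norm (h s) \<le> M"
    using compact_imp_bounded bounded_iff by (metis imageI)
  have bound: "norm (h s) \<le> M" for s
  proof -
    have "h s = h (frac s)" using h_add[of "frac s" "of_int \<lfloor>s\<rfloor>"] h_int by (simp add: frac_def)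
    then show ?thesis using M[of "frac s"] frac_lt_1[of s] by (simp add: less_imp_le)
  qed
  have "h r = 0"
  proof (rule ccontr)
    assume "h r \<noteq> 0"
    then obtain n :: nat where "M < real n * norm (h r)"
      using reals_Archimedean3[of "norm (h r)"] by auto
    then show False using bound[of "real n * r"] by (simp add: h_nat)
  qed
  then show ?thesis by (simp add: h_def)
qed

text \<open>A continuous logarithm of \<open>f\<close> exists since the space is contractible. It is additive up to a
  continuous function with values in \<open>2\<pi>\<i>\<int>\<close>, which is constant, and is therefore real-linear;
  periodicity makes its values at the unit vectors multiples of \<open>2\<pi>\<i>\<close>.\<close>

lemma continuous_multiplicative_is_character:
  fixes f :: "real^'d \<Rightarrow> complex"
  assumes cont: "continuous_on UNIV f" and per: "torus_periodic 1 f"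
    and one: "f 0 = 1" and mult: "\<And>\<theta> \<eta>. f (\<theta> + \<eta>) = f \<theta> * f \<eta>"
  obtains k where "k \<in> integer_vectors" "f = character k"
proof -
  have nz: "f \<theta> \<noteq> 0" for \<theta>
    using mult[of \<theta> "-\<theta>"] one by auto
  obtain g0 where g0: "continuous_on UNIV g0" "\<And>\<theta>. f \<theta> = exp (g0 \<theta>)"
    using continuous_logarithm_on_contractible[OF cont] nz
    by (metis UNIV_I convex_UNIV convex_imp_contractible)
  define g where "g \<theta> = g0 \<theta> - g0 0" for \<theta>
  have gc: "continuous_on UNIV g" unfolding g_def by (intro continuous_intros g0)
  have gf: "exp (g \<theta>) = f \<theta>" for \<theta>
    using g0(2)[of 0] one by (simp add: g_def exp_diff g0(2)[symmetric])
  have g_zero: "g 0 = 0" by (simp add: g_def)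
  have add: "g (\<theta> + \<eta>) = g \<theta> + g \<eta>" for \<theta> \<eta>
  proof -
    define h where "h \<theta> = g (\<theta> + \<eta>) - g \<theta> - g \<eta>" for \<theta>
    have hc: "continuous_on UNIV h"
      unfolding h_def by (intro continuous_intros continuous_on_compose2[OF gc]) auto
    have hv: "exp (h \<theta>) = 1" for \<theta>
      by (simp add: h_def exp_diff gf mult nz)
    have "h constant_on UNIV"
    proof (rule continuous_discrete_range_constant[OF _ hc])
      show "connected (UNIV :: (real^'d) set)" by (rule convex_connected) simp
      fix x :: "real^'d"
      have "2 * pi \<le> norm (h y - h x)" if "h y \<noteq> h x" for y
      proof -
        have "exp (h y) = exp (h x)" by (simp add: hv)
        then obtain n :: int where n: "h y = h x + (of_int (2 * n) * pi) * \<i>"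
          using exp_eq by blast
        then have "n \<noteq> 0" using that by auto
        then have "1 \<le> \<bar>real_of_int n\<bar>" by linarith
        moreover have "norm (h y - h x) = 2 * \<bar>real_of_int n\<bar> * pi"
          by (simp add: n norm_mult)
        ultimately show ?thesis using pi_gt_zero by simp
      qed
      then show "\<exists>e>0. \<forall>y. y \<in> UNIV \<and> h y \<noteq> h x \<longrightarrow> e \<le> cmod (h y - h x)"
        by (intro exI[of _ "2 * pi"]) auto
    qed
    then have "h \<theta> = h 0" by (auto simp: constant_on_def)
    then show ?thesis by (simp add: h_def g_zero algebra_simps)
  qed
  have scale: "g (r *\<^sub>R x) = r *\<^sub>R g x" for r x
    by (rule continuous_additive_scaleR[OF gc add])
  have g_sum: "g (sum h S) = (\<Sum>i\<in>S. g (h i))" if "finite S" for h and S :: "'d set"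
    using that by (induction S rule: finite_induct) (simp_all add: add g_zero)
  have "\<exists>n::int. g (axis i 1) = \<i> * of_real (2 * pi * of_int n)" for i
  proof -
    have "axis i 1 \<in> integer_vectors" by (simp add: integer_vectors_def axis_def)
    then have "f (0 + axis i 1) = f 0" using per unfolding torus_periodic_def by (metis of_nat_1 scaleR_one)
    then have "exp (g (axis i 1)) = 1" by (simp add: gf one)
    then obtain n :: int where "Re (g (axis i 1)) = 0" "Im (g (axis i 1)) = of_int (2 * n) * pi"
      using exp_eq_1 by blast
    then show ?thesis by (intro exI[of _ n]) (simp add: complex_eq_iff)
  qed
  then obtain n :: "'d \<Rightarrow> int" where n: "\<And>i. g (axis i 1) = \<i> * of_real (2 * pi * of_int (n i))"
    by metis
  define k :: "real^'d" where "k = (\<chi> i. of_int (n i))"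
  have "f \<theta> = character k \<theta>" for \<theta>
  proof -
    have "g \<theta> = g (\<Sum>i\<in>UNIV. \<theta> $ i *\<^sub>R axis i 1)"
      by (simp add: basis_expansion flip: scalar_mult_eq_scaleR)
    also have "\<dots> = \<i> * of_real (2 * pi * (k \<bullet> \<theta>))"
      by (simp add: g_sum scale n k_def inner_vec_def sum_distrib_left)
        (simp add: scaleR_conv_of_real mult_ac)
    finally show ?thesis by (simp add: gf[symmetric] character_def cis_conv_exp)
  qed
  moreover have "k \<in> integer_vectors" by (simp add: k_def integer_vectors_def)
  ultimately show ?thesis using that by blast
qed

lemma bounded_torus_periodic:
  fixes f :: "real^'d \<Rightarrow> 'a::metric_space"
  assumes "continuous_on UNIV f" "torus_periodic 1 f"
  shows "bounded (range f)"
proof -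
  have "range f \<subseteq> f ` cbox 0 1"
  proof
    fix y assume "y \<in> range f"
    then obtain \<theta> where y: "y = f \<theta>" by blast
    define k :: "real^'d" where "k = (\<chi> i. - of_int \<lfloor>\<theta> $ i\<rfloor>)"
    have "k \<in> integer_vectors" by (simp add: k_def integer_vectors_def)
    then have "f (\<theta> + k) = y" using assms(2) y by (auto simp: torus_periodic_def)
    moreover have "\<theta> + k \<in> cbox 0 1"
      by (auto simp: mem_box_cart k_def) linarith
    ultimately show "y \<in> f ` cbox 0 1" by blast
  qed
  moreover have "compact (f ` cbox 0 1)"
    by (intro compact_continuous_image continuous_on_subset[OF assms(1)]) auto
  ultimately show ?thesis using compact_imp_bounded bounded_subset by blast
qed

lemma torus_periodic_shift:
  fixes f :: "real^'d \<Rightarrow> 'b"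
  assumes "torus_periodic N f"
  shows "torus_periodic N (\<lambda>\<theta>. f (\<theta> + \<omega>))"
  unfolding torus_periodic_def
proof (intro allI ballI)
  fix \<theta> k :: "real^'d" assume "k \<in> integer_vectors"
  then have "f ((\<theta> + \<omega>) + real N *\<^sub>R k) = f (\<theta> + \<omega>)"
    using assms by (simp add: torus_periodic_def)
  then show "f (\<theta> + real N *\<^sub>R k + \<omega>) = f (\<theta> + \<omega>)" by (simp add: ac_simps)
qed

text \<open>Along the orbit of the origin the identity \<open>u (\<theta> + \<eta>) u(0) = u \<theta> u \<eta>\<close> holds because both sides pick up
  the same power of \<open>c\<close>. The orbit is dense, so the identity holds everywhere and \<open>u / u(0)\<close> is
  multiplicative.\<close>

lemma shift_eigenfunction_is_character:
  fixes u :: "real^'d \<Rightarrow> complex"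
  assumes ri: "rationally_independent \<omega>" and cont: "continuous_on UNIV u" and per: "torus_periodic 1 u"
    and eig: "\<And>\<theta>. u (\<theta> + \<omega>) = c * u \<theta>" and nz: "u \<theta>\<^sub>0 \<noteq> 0"
  obtains k where "k \<in> integer_vectors" "c = character k \<omega>" "u 0 \<noteq> 0" "\<And>\<theta>. u \<theta> = u 0 * character k \<theta>"
proof -
  have "c \<noteq> 0" using eig[of "\<theta>\<^sub>0 - \<omega>"] nz by auto
  have shift: "u (\<theta> + of_int m *\<^sub>R \<omega>) = c powi m * u \<theta>" for m \<theta>
  proof (induction m rule: int_induct[of _ 0])
    case (step1 i)
    then show ?case using eig[of "\<theta> + of_int i *\<^sub>R \<omega>"] \<open>c \<noteq> 0\<close>
      by (simp add: power_int_add algebra_simps)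
  next
    case (step2 i)
    then show ?case using eig[of "\<theta> + of_int (i - 1) *\<^sub>R \<omega>"] \<open>c \<noteq> 0\<close>
      by (simp add: power_int_diff algebra_simps)
  qed simp
  have key: "u (\<theta> + \<eta>) * u 0 = u \<theta> * u \<eta>" for \<theta> \<eta>
  proof -
    define S where "S = {\<eta>. u (\<theta> + \<eta>) * u 0 = u \<theta> * u \<eta>}"
    have "closed S"
      unfolding S_def
      by (intro closed_Collect_eq continuous_intros continuous_on_compose2[OF cont]) auto
    moreover have "of_int m *\<^sub>R \<omega> + k \<in> S" if "k \<in> integer_vectors" for m k
    proof -
      have p: "u (x + k) = u x" for x using per that by (simp add: torus_periodic_def)
      show ?thesis unfolding S_def
        using shift[of \<theta> m] shift[of 0 m] p[of "\<theta> + of_int m *\<^sub>R \<omega>"] p[of "of_int m *\<^sub>R \<omega>"]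
        by (simp add: add.assoc)
    qed
    ultimately have "\<eta> \<in> S"
      by (metis closed_approachable orbit_dense[OF ri])
    then show ?thesis by (simp add: S_def)
  qed
  have u0: "u 0 \<noteq> 0" using key[of \<theta>\<^sub>0 \<theta>\<^sub>0] nz by auto
  have "continuous_on UNIV (\<lambda>\<theta>. u \<theta> / u 0)" using u0 by (intro continuous_intros cont) auto
  moreover have "torus_periodic 1 (\<lambda>\<theta>. u \<theta> / u 0)" using per by (simp add: torus_periodic_def)
  moreover have "u (\<theta> + \<eta>) / u 0 = (u \<theta> / u 0) * (u \<eta> / u 0)" for \<theta> \<eta>
    using key[of \<theta> \<eta>] u0 by (simp add: field_simps)
  ultimately obtain k where k: "k \<in> integer_vectors" "(\<lambda>\<theta>. u \<theta> / u 0) = character k"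
    using continuous_multiplicative_is_character[of "\<lambda>\<theta>. u \<theta> / u 0"] u0 by auto
  then have eq: "u \<theta> = u 0 * character k \<theta>" for \<theta> using u0 by (metis nonzero_mult_div_cancel_left times_divide_eq_right)
  moreover have "c = character k \<omega>" using eig[of 0] eq[of \<omega>] u0 by simp
  ultimately show ?thesis using that k u0 by blast
qed

text \<open>A Jordan block for the translation would make \<open>v\<close> grow linearly along the orbit of the origin,
  but a continuous function on the torus is bounded.\<close>

lemma shift_semisimple:
  fixes v :: "real^'d \<Rightarrow> complex"
  assumes ri: "rationally_independent \<omega>" and cont: "continuous_on UNIV v" and per: "torus_periodic 1 v"
    and eig: "\<And>\<theta>. v (\<theta> + \<omega> + \<omega>) - c * v (\<theta> + \<omega>) = c * (v (\<theta> + \<omega>) - c * v \<theta>)"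
  shows "v (\<theta> + \<omega>) = c * v \<theta>"
proof (rule ccontr)
  define u where "u \<theta> = v (\<theta> + \<omega>) - c * v \<theta>" for \<theta>
  assume "v (\<theta> + \<omega>) \<noteq> c * v \<theta>"
  then have nz: "u \<theta> \<noteq> 0" by (simp add: u_def)
  have uc: "continuous_on UNIV u"
    unfolding u_def by (intro continuous_intros cont continuous_on_compose2[OF cont]) auto
  have up: "torus_periodic 1 u"
    using per torus_periodic_shift[OF per, of \<omega>] by (simp add: u_def torus_periodic_def)
  have ue: "u (\<theta> + \<omega>) = c * u \<theta>" for \<theta> using eig by (simp add: u_def)
  obtain k where k: "k \<in> integer_vectors" "c = character k \<omega>" "u 0 \<noteq> 0"
    using shift_eigenfunction_is_character[OF ri uc up ue nz] by metis
  then have nc: "norm c = 1" "c \<noteq> 0" by auto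
  have um: "u (real m *\<^sub>R \<omega>) = c ^ m * u 0" for m
  proof (induction m)
    case (Suc m)
    then show ?case using ue[of "real m *\<^sub>R \<omega>"] by (simp add: algebra_simps)
  qed simp
  have grow: "c * v (real m *\<^sub>R \<omega>) = c ^ m * (c * v 0 + of_nat m * u 0)" for m
  proof (induction m)
    case (Suc m)
    have "v (real (Suc m) *\<^sub>R \<omega>) = u (real m *\<^sub>R \<omega>) + c * v (real m *\<^sub>R \<omega>)"
      by (simp add: u_def algebra_simps)
    then show ?case using Suc um[of m] by (simp add: algebra_simps)
  qed simp
  obtain M where M: "\<And>\<theta>. norm (v \<theta>) \<le> M"
    using bounded_torus_periodic[OF cont per] by (auto simp: bounded_iff)
  \<comment> \<open>For this \<open>m\<close> the linear growth exceeds the bound \<open>M\<close> on \<open>v\<close>.\<close>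
  obtain m :: nat where m: "2 * M < real m * norm (u 0)"
    using k(3) reals_Archimedean3[of "norm (u 0)"] by auto
  have "norm (c * v 0 + of_nat m * u 0) = norm (v (real m *\<^sub>R \<omega>))"
    using arg_cong[OF grow[of m], of norm] nc by (simp add: norm_mult norm_power)
  then have "norm (of_nat m * u 0) \<le> norm (v (real m *\<^sub>R \<omega>)) + norm (c * v 0)"
    using norm_triangle_ineq4[of "c * v 0 + of_nat m * u 0" "c * v 0"] by simp
  then show False using m M[of "real m *\<^sub>R \<omega>"] M[of 0] nc by (simp add: norm_mult)
qed

text \<open>Functions on the torus of side length 2 become functions on the torus of side length 1 after
  rescaling the argument, and the translation vector is then halved.\<close>

lemma rationally_independent_half:
  assumes "rationally_independent \<omega>"
  shows "rationally_independent ((1 / 2) *\<^sub>R \<omega>)"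
  unfolding rationally_independent_def
proof (intro ballI impI notI)
  fix p :: "(real^'a) \<times> real"
  assume p: "p \<in> integer_vectors \<times> \<int>" "p \<noteq> 0" "p \<bullet> ((1 / 2) *\<^sub>R \<omega>, 1) = 0"
  obtain k l where kl: "p = (k, l)" by (cases p)
  then have "(k, 2 * l) \<in> integer_vectors \<times> \<int>" "(k, 2 * l) \<noteq> 0" "(k, 2 * l) \<bullet> (\<omega>, 1) = 0"
    using p by (auto simp: zero_prod_def)
  then show False using assms unfolding rationally_independent_def by blast
qed

text \<open>After rescaling, \<open>u\<close> is a character, and a nontrivial character takes the value \<open>\<i>\<close>.\<close>

lemma real_shift_eigenfunction_constant:
  fixes u :: "real^'d \<Rightarrow> complex"
  assumes ri: "rationally_independent \<omega>" and cont: "continuous_on UNIV u" and per: "torus_periodic 2 u"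
    and eig: "\<And>\<theta>. u (\<theta> + \<omega>) = c * u \<theta>" and one: "u 0 = 1" and real: "\<And>\<theta>. u \<theta> \<in> \<real>"
  shows "u \<theta> = 1"
proof -
  define v where "v \<theta> = u (2 *\<^sub>R \<theta>)" for \<theta>
  have vc: "continuous_on UNIV v"
    unfolding v_def by (intro continuous_on_compose2[OF cont] continuous_intros) auto
  have vp: "torus_periodic 1 v"
    using per by (simp add: v_def torus_periodic_def scaleR_right_distrib)
  have ve: "v (\<theta> + (1 / 2) *\<^sub>R \<omega>) = c * v \<theta>" for \<theta>
    using eig[of "2 *\<^sub>R \<theta>"] by (simp add: v_def scaleR_right_distrib)
  have v0: "v 0 = 1" by (simp add: v_def one)
  then have "v 0 \<noteq> 0" by simp
  obtain k where k: "\<And>\<theta>. v \<theta> = v 0 * character k \<theta>"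
    using shift_eigenfunction_is_character[OF rationally_independent_half[OF ri] vc vp ve \<open>v 0 \<noteq> 0\<close>] by metis
  have "k = 0"
  proof (rule ccontr)
    assume "k \<noteq> 0"
    \<comment> \<open>The point is chosen on the line through \<open>k\<close> such that the phase is a quarter turn.\<close>
    then have "character k ((1 / (4 * (k \<bullet> k))) *\<^sub>R k) = \<i>"
      by (simp add: character_def complex_eq_iff cos_pi_half sin_pi_half field_simps)
    then have "v ((1 / (4 * (k \<bullet> k))) *\<^sub>R k) = \<i>" using k v0 by simp
    then show False using real unfolding v_def by (metis complex_is_Real_iff imaginary_unit.sel(2) zero_neq_one)
  qed
  then show ?thesis using k[of "(1 / 2) *\<^sub>R \<theta>"] v0 by (simp add: v_def)
qed

section \<open>Resonance indices\<close>

text \<open>Eigenvalues count as equivalent if they are resonant up to a positive factor. Forgetting the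
  modulus makes the inverse of a number equivalent to its conjugate, so that conjugation and
  inversion can be handled by one symmetry.\<close>

definition same_orbit :: "real^'d \<Rightarrow> complex \<Rightarrow> complex \<Rightarrow> bool" where
  "same_orbit \<omega> a b \<longleftrightarrow> (\<exists>t>0. \<exists>k\<in>integer_vectors. b = of_real t * character k \<omega> * a)"

lemma same_orbit_refl: "same_orbit \<omega> a a"
  unfolding same_orbit_def
  by (intro exI[of _ 1] conjI bexI[of _ 0]) (auto simp: integer_vectors_def)

lemma same_orbit_sym: "same_orbit \<omega> a b \<Longrightarrow> same_orbit \<omega> b a"
  unfolding same_orbit_def
proof (elim exE conjE bexE)
  fix t k assume "0 < t" "k \<in> integer_vectors" "b = of_real t * character k \<omega> * a"
  then show "\<exists>t>0. \<exists>k\<in>integer_vectors. a = of_real t * character k \<omega> * b"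
    by (intro exI[of _ "inverse t"] conjI bexI[of _ "- k"])
      (auto simp: integer_vectors_minus character_uminus_left field_simps)
qed

lemma same_orbit_trans: "same_orbit \<omega> a b \<Longrightarrow> same_orbit \<omega> b c \<Longrightarrow> same_orbit \<omega> a c"
  unfolding same_orbit_def
proof (elim exE conjE bexE)
  fix t k s l assume "0 < t" "k \<in> integer_vectors" "b = of_real t * character k \<omega> * a"
    "0 < s" "l \<in> integer_vectors" "c = of_real s * character l \<omega> * b"
  then show "\<exists>t>0. \<exists>k\<in>integer_vectors. c = of_real t * character k \<omega> * a"
    by (intro exI[of _ "s * t"] conjI bexI[of _ "l + k"])
      (auto simp: integer_vectors_add character_add_left)
qed

text \<open>If \<open>a = e(k \<cdot> \<omega>) b\<close> is a resonance, then \<open>e(- \<rho>(a) \<cdot> \<omega>) a = e(- \<rho>(b) \<cdot> \<omega>) b\<close>: turning every eigenvalue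
  back by its index makes resonant eigenvalues equal.\<close>

definition resonance_index :: "real^'d \<Rightarrow> (complex \<Rightarrow> real^'d) \<Rightarrow> bool" where
  "resonance_index \<omega> \<rho> \<longleftrightarrow>
     (\<forall>z k. z \<noteq> 0 \<longrightarrow> k \<in> integer_vectors \<longrightarrow> \<rho> (character k \<omega> * z) = \<rho> z + k)"

text \<open>Choose a representative of every orbit and let \<open>\<kappa> a\<close> be the frequency that leads from the
  representative to \<open>a\<close>; rational independence makes this frequency unique.\<close>

lemma ex_resonance_index:
  fixes \<omega> :: "real^'d"
  assumes ri: "rationally_independent \<omega>"
  obtains \<kappa> :: "complex \<Rightarrow> real^'d" where
    "\<And>a. \<kappa> a \<in> integer_vectors"
    "resonance_index \<omega> \<kappa>"
    "\<And>a t. t > 0 \<Longrightarrow> \<kappa> (of_real t * a) = \<kappa> a"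
proof -
  define r where "r a = (SOME b. same_orbit \<omega> b a)" for a
  have r: "same_orbit \<omega> (r a) a" for a
    unfolding r_def by (rule someI) (rule same_orbit_refl)
  have r_eq: "r a = r b" if "same_orbit \<omega> a b" for a b
    using that unfolding r_def by (metis same_orbit_trans same_orbit_sym)
  define P where "P a k \<longleftrightarrow> k \<in> integer_vectors \<and> (\<exists>t>0. a = of_real t * character k \<omega> * r a)" for a k
  \<comment> \<open>At 0 the frequency is not unique; any integer vector will do there.\<close>
  define \<kappa> where "\<kappa> a = (if a = 0 then 0 else SOME k. P a k)" for a
  have P: "P a (\<kappa> a)" if "a \<noteq> 0" for a
  proof -
    have "\<exists>k. P a k" using r[of a] unfolding same_orbit_def P_def by blast
    then show ?thesis using someI_ex[of "P a"] that by (simp add: \<kappa>_def)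
  qed
  have eq: "\<kappa> a = k" if "P a k" "a \<noteq> 0" for a k
  proof -
    obtain t where t: "t > 0" "a = of_real t * character k \<omega> * r a" and k: "k \<in> integer_vectors"
      using \<open>P a k\<close> by (auto simp: P_def)
    obtain s where s: "s > 0" "a = of_real s * character (\<kappa> a) \<omega> * r a" and l: "\<kappa> a \<in> integer_vectors"
      using P[OF \<open>a \<noteq> 0\<close>] by (auto simp: P_def)
    have "r a \<noteq> 0" using t \<open>a \<noteq> 0\<close> by auto
    then have *: "of_real s * character (\<kappa> a) \<omega> = of_real t * character k \<omega>"
      using t s by (metis mult_right_cancel)
    have "s = t" using arg_cong[OF *, of norm] s(1) t(1) by (simp add: norm_mult)
    then have "character (\<kappa> a - k) \<omega> = 1"
      using * t(1) by (simp add: diff_conv_add_uminus character_add_left character_uminus_left del: add_uminus_conv_diff)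
    then have "\<kappa> a - k = 0"
      using character_eq_1_imp_0[OF ri integer_vectors_diff[OF l k]] by blast
    then show ?thesis by simp
  qed
  show ?thesis
  proof
    show "\<kappa> a \<in> integer_vectors" for a
      using P[of a] by (cases "a = 0") (auto simp: \<kappa>_def P_def integer_vectors_def)
    show "resonance_index \<omega> \<kappa>"
      unfolding resonance_index_def
    proof (intro allI impI eq)
      fix a :: complex and k :: "real^'d" assume a: "a \<noteq> 0" and k: "k \<in> integer_vectors"
      have "same_orbit \<omega> a (character k \<omega> * a)"
        unfolding same_orbit_def using k by (intro exI[of _ 1]) auto
      then have "r (character k \<omega> * a) = r a" by (simp add: r_eq)
      moreover obtain t where "t > 0" "a = of_real t * character (\<kappa> a) \<omega> * r a" "\<kappa> a \<in> integer_vectors"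
        using P[OF a] by (auto simp: P_def)
      ultimately show "P (character k \<omega> * a) (\<kappa> a + k)"
        unfolding P_def using k
        by (auto simp: integer_vectors_add character_add_left mult.assoc intro!: exI[of _ t])
      show "character k \<omega> * a \<noteq> 0" using a by simp
    qed
    show "\<kappa> (of_real t * a) = \<kappa> a" if t: "t > 0" for a t
    proof (cases "a = 0")
      case False
      show ?thesis
      proof (rule eq)
        have "same_orbit \<omega> a (of_real t * a)"
          unfolding same_orbit_def using t
          by (intro exI[of _ t] conjI bexI[of _ 0]) (auto simp: integer_vectors_def)
        then have "r (of_real t * a) = r a" by (simp add: r_eq)
        moreover obtain s where "s > 0" "a = of_real s * character (\<kappa> a) \<omega> * r a" "\<kappa> a \<in> integer_vectors"
          using P[OF False] by (auto simp: P_def)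
        ultimately show "P (of_real t * a) (\<kappa> a)"
          unfolding P_def using t by (auto simp: mult.assoc intro!: exI[of _ "t * s"])
      qed (use t False in auto)
    qed simp
  qed
qed

lemma inverse_eq_scaled_cnj:
  assumes "z \<noteq> 0"
  shows "inverse z = of_real (inverse ((norm z)\<^sup>2)) * cnj z"
  using assms complex_norm_square[of z] by (simp add: field_simps)

text \<open>Antisymmetrizing an integer-valued index \<open>\<kappa>\<close> under conjugation gives \<open>\<rho> z = (\<kappa> z - \<kappa> (cnj z)) / 2\<close>.
  The shift rule survives because \<open>\<kappa> z\<close> and \<open>\<kappa> (cnj z)\<close> shift in opposite directions. The division by 2
  is the origin of the double covering of the torus.\<close>

lemma ex_half_resonance_index:
  fixes \<omega> :: "real^'d"
  assumes ri: "rationally_independent \<omega>"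
  obtains \<rho> :: "complex \<Rightarrow> real^'d" where
    "resonance_index \<omega> \<rho>"
    "\<And>z. real 2 *\<^sub>R \<rho> z \<in> integer_vectors"
    "\<And>z. \<rho> (cnj z) = - \<rho> z" "\<And>z. z \<noteq> 0 \<Longrightarrow> \<rho> (inverse z) = - \<rho> z"
proof -
  obtain \<kappa> :: "complex \<Rightarrow> real^'d" where int: "\<And>a. \<kappa> a \<in> integer_vectors"
    and \<kappa>: "resonance_index \<omega> \<kappa>"
    and pos: "\<And>a t. t > 0 \<Longrightarrow> \<kappa> (of_real t * a) = \<kappa> a"
    using ex_resonance_index[OF ri] by metis
  have shift: "\<kappa> (character k \<omega> * a) = \<kappa> a + k" if "a \<noteq> 0" "k \<in> integer_vectors" for a k
    using \<kappa> that by (simp add: resonance_index_def)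
  define \<rho> where "\<rho> z = (1 / 2) *\<^sub>R (\<kappa> z - \<kappa> (cnj z))" for z
  show ?thesis
  proof (rule that[of \<rho>])
    show "resonance_index \<omega> \<rho>"
      unfolding resonance_index_def
    proof (intro allI impI)
      fix z :: complex and k :: "real^'d" assume that: "z \<noteq> 0" "k \<in> integer_vectors"
      have "\<kappa> (cnj (character k \<omega> * z)) = \<kappa> (cnj z) + - k"
        using shift[of "cnj z" "- k"] that by (simp add: cnj_character integer_vectors_minus)
      then have "\<rho> (character k \<omega> * z) = (1 / 2) *\<^sub>R ((\<kappa> z + k) - (\<kappa> (cnj z) + - k))"
        by (simp only: \<rho>_def shift[OF that])
      also have "(\<kappa> z + k) - (\<kappa> (cnj z) + - k) = (\<kappa> z - \<kappa> (cnj z)) + (k + k)"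
        by (simp only: diff_conv_add_uminus minus_add_distrib minus_minus add_ac)
      also have "(1 / 2) *\<^sub>R \<dots> = \<rho> z + k"
        by (simp only: \<rho>_def scaleR_right_distrib[of _ _ "k + k"] scaleR_half_double)
      finally show "\<rho> (character k \<omega> * z) = \<rho> z + k" .
    qed
    show "real 2 *\<^sub>R \<rho> z \<in> integer_vectors" for z
      by (simp add: \<rho>_def integer_vectors_diff int)
    show "\<rho> (cnj z) = - \<rho> z" for z
      by (simp add: \<rho>_def flip: scaleR_minus_right)
    show "\<rho> (inverse z) = - \<rho> z" if "z \<noteq> 0" for z
    proof -
      have "\<kappa> (inverse w) = \<kappa> (cnj w)" if "w \<noteq> 0" for w
        unfolding inverse_eq_scaled_cnj[OF that] using that by (intro pos) simp
      from this[OF that] this[of "cnj z"] that show ?thesis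
        by (simp add: \<rho>_def flip: scaleR_minus_right)
    qed
  qed
qed

section \<open>Matrix algebra\<close>

lemma mat_mult_nth: "(mat c ** M) $ i $ j = c * M $ i $ j"
  and mult_mat_nth: "(M ** mat c) $ i $ j = M $ i $ j * c"
  for M :: "complex^'n^'n"
  by (simp_all add: matrix_matrix_mult_def mat_def if_distrib[of "\<lambda>x. x * _"] if_distrib[of "\<lambda>x. _ * x"] cong: if_cong)

lemma mat_commute: "M ** mat c = mat c ** M" for M :: "complex^'n^'n"
  by (simp add: vec_eq_iff mat_mult_nth mult_mat_nth mult.commute)

lemma mult_mat_assoc: "M ** (mat c ** N) = mat c ** (M ** N)" for M N :: "complex^'n^'n"
  by (metis mat_commute matrix_mul_assoc)

lemma mat_mult_mat: "mat c ** mat d = (mat (c * d) :: complex^'n^'n)"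
  by (simp add: vec_eq_iff mat_mult_nth) (simp add: mat_def)

lemma mat_add: "mat (c + d) = mat c + (mat d :: complex^'n^'n)"
  by (simp add: vec_eq_iff mat_def)

lemma mult_zero_matrix [simp]: "M ** 0 = 0" "0 ** M = 0" for M :: "complex^'n^'n"
  by (simp_all add: matrix_matrix_mult_def vec_eq_iff)

lemma matrix_mult_add_right: "(A + B) ** C = A ** C + B ** C" for A B C :: "complex^'n^'n"
  by (simp add: matrix_matrix_mult_def vec_eq_iff distrib_right sum.distrib)

lemma matrix_mult_diff: "(A - B) ** C = A ** C - B ** C" "C ** (A - B) = C ** A - C ** B"
  for A B C :: "complex^'n^'n"
  by (simp_all add: matrix_matrix_mult_def vec_eq_iff left_diff_distrib right_diff_distrib sum_subtractf)

lemma matrix_mult_sum: "sum f S ** C = (\<Sum>i\<in>S. f i ** C)" "C ** sum f S = (\<Sum>i\<in>S. C ** f i)"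
  for C :: "complex^'n^'n"
  by (induction S rule: infinite_finite_induct)
    (auto simp: matrix_mult_add_right matrix_add_ldistrib)

lemma mat_mult_inj: "c \<noteq> 0 \<Longrightarrow> mat c ** M = 0 \<longleftrightarrow> M = 0" for M :: "complex^'n^'n"
  by (simp add: vec_eq_iff mat_mult_nth)

lemma scaled_matrix_mult: "(mat c ** M) ** (mat d ** N) = mat (c * d) ** (M ** N)"
  for M N :: "complex^'n^'n"
  by (metis mat_mult_mat mult_mat_assoc matrix_mul_assoc)

lemma scaled_matrix_mult3: "(mat c ** M) ** W ** (mat d ** N) = mat (c * d) ** (M ** W ** N)"
  for M N W :: "complex^'n^'n"
  by (metis matrix_mul_assoc scaled_matrix_mult)

lemma matrix_inv:
  assumes "invertible M"
  shows matrix_inv_right: "M ** matrix_inv M = mat 1" and matrix_inv_left: "matrix_inv M ** M = mat 1"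
  using assms unfolding invertible_def matrix_inv_def by (metis (mono_tags, lifting) someI_ex)+

lemma matrix_inv_unique:
  fixes M :: "'a::semiring_1^'n^'n"
  assumes "M ** N = mat 1" "N ** M = mat 1"
  shows "matrix_inv M = N"
proof -
  have "invertible M" using assms unfolding invertible_def by blast
  then show ?thesis by (metis assms(1) matrix_inv_left matrix_mul_assoc matrix_mul_lid matrix_mul_rid)
qed

lemma matrix_inv_cancel:
  fixes M N :: "'a::semiring_1^'n^'n"
  assumes "invertible M"
  shows "M ** (matrix_inv M ** N) = N" "matrix_inv M ** (M ** N) = N"
  using assms by (simp_all add: matrix_mul_assoc matrix_inv_right matrix_inv_left)

lemma invertible_matrix_inv: "invertible M \<Longrightarrow> invertible (matrix_inv M)"
  using matrix_inv_right matrix_inv_left unfolding invertible_def by blast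

lemma invertible_mat_1: "invertible (mat 1 :: 'a::semiring_1^'n^'n)"
  unfolding invertible_def by (rule exI[of _ "mat 1"]) simp

lemma matrix_inv_mult:
  fixes M N :: "'a::semiring_1^'n^'n"
  assumes "invertible M" "invertible N"
  shows "matrix_inv (M ** N) = matrix_inv N ** matrix_inv M"
  by (rule matrix_inv_unique)
    (simp_all add: assms matrix_inv_cancel matrix_inv_right matrix_inv_left flip: matrix_mul_assoc)

lemma invertible_mult_left_cancel:
  fixes A :: "complex^'n^'n"
  assumes "invertible A" "A ** M = A ** N"
  shows "M = N"
  using assms unfolding invertible_def by (metis matrix_mul_assoc matrix_mul_lid)

lemma funpow_intertwine:
  assumes "\<And>y. g (f y) = h (g y)"
  shows "g ((f ^^ n) x) = (h ^^ n) (g x)"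
  by (induction n) (simp_all add: assms)

text \<open>Left and right multiplication by \<open>X\<close> agree on matrices that commute with \<open>X\<close>; this allows
  nilpotency to be stated with left multiplication only.\<close>

lemma funpow_mult_commute:
  assumes "M ** X = X ** M"
  shows "((\<lambda>M. M ** X) ^^ n) M = (((**) X) ^^ n) M"
proof (induction n)
  case (Suc n)
  have "(((**) X) ^^ n) M ** X = (((**) X) ^^ n) (M ** X)"
    by (rule funpow_intertwine) (simp add: matrix_mul_assoc)
  then show ?case using Suc assms by (simp add: funpow_swap1)
qed simp

lemma continuous_on_mat [continuous_intros]:
  fixes f :: "'a::topological_space \<Rightarrow> complex"
  assumes "continuous_on S f"
  shows "continuous_on S (\<lambda>x. mat (f x) :: complex^'n^'n)"
proof -
  have "continuous_on S (\<lambda>x. if i = j then f x else 0)" for i j :: 'n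
    by (cases "i = j") (simp_all add: assms)
  then show ?thesis unfolding mat_def by (intro continuous_on_vec_lambda)
qed

lemma continuous_on_matrix_mult [continuous_intros]:
  fixes f g :: "'a::topological_space \<Rightarrow> complex^'n^'n"
  assumes "continuous_on S f" "continuous_on S g"
  shows "continuous_on S (\<lambda>x. f x ** g x)"
  unfolding matrix_matrix_mult_def
  by (intro continuous_intros continuous_on_vec_lambda continuous_on_component assms)

lemma continuous_on_det [continuous_intros]:
  fixes f :: "'a::topological_space \<Rightarrow> complex^'n^'n"
  assumes "continuous_on S f"
  shows "continuous_on S (\<lambda>x. det (f x))"
  unfolding det_def by (intro continuous_intros continuous_on_component assms)

text \<open>By Cramer's rule the entries of the inverse are quotients of determinants.\<close>

lemma continuous_on_matrix_inv:
  "continuous_on {M. invertible M} (matrix_inv :: complex^'n^'n \<Rightarrow> complex^'n^'n)"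
proof -
  define cof :: "complex^'n^'n \<Rightarrow> complex^'n^'n" where
    "cof M = (\<chi> k l. det (\<chi> i j. if j = k then axis l 1 $ i else M $ i $ j) / det M)" for M
  have inv_eq: "matrix_inv M = cof M" if "invertible M" for M
  proof -
    have "matrix_inv M *v axis l 1 = (\<chi> k. cof M $ k $ l)" for l
    proof -
      have "det M \<noteq> 0" using that by (simp add: invertible_det_nz)
      moreover have "M *v (matrix_inv M *v axis l 1) = axis l 1"
        by (simp add: matrix_vector_mul_assoc matrix_inv_right that)
      ultimately show ?thesis
        using cramer[of M "matrix_inv M *v axis l 1" "axis l 1"]
        by (simp add: cof_def)
    qed
    moreover have "(N *v axis l 1) $ k = N $ k $ l" for N :: "complex^'n^'n" and k l
      by (simp add: matrix_vector_mult_def axis_def if_distrib cong: if_cong)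
    ultimately show ?thesis by (simp add: vec_eq_iff)
  qed
  have "continuous_on {M. invertible M} cof"
    unfolding cof_def
  proof (intro continuous_on_vec_lambda continuous_on_divide continuous_on_det)
    show "continuous_on {M. invertible M} (\<lambda>M :: complex^'n^'n. if j = k then axis l 1 $ i else M $ i $ j)"
      for i j k l :: 'n
      by (cases "j = k") (auto intro!: continuous_intros)
    show "\<forall>M \<in> {M. invertible M}. det (M :: complex^'n^'n) \<noteq> 0"
      by (simp add: invertible_det_nz)
  qed (rule continuous_on_id)
  then show ?thesis by (rule continuous_on_eq) (simp add: inv_eq)
qed

section \<open>Spectral resolutions\<close>

text \<open>Horner's scheme for the matrix product; the ring operation \<open>*\<close> on the type of matrices, and with it
  \<open>poly\<close>, is componentwise.\<close>

definition poly_matrix :: "complex poly \<Rightarrow> complex^'n^'n \<Rightarrow> complex^'n^'n" where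
  "poly_matrix p A = fold_coeffs (\<lambda>a M. mat a + A ** M) p 0"

lemma poly_matrix_0 [simp]: "poly_matrix 0 A = 0"
  by (simp add: poly_matrix_def)

lemma poly_matrix_pCons [simp]: "poly_matrix (pCons a p) A = mat a + A ** poly_matrix p A"
  by (cases "p = 0 \<and> a = 0") (auto simp: poly_matrix_def)

lemma poly_matrix_add: "poly_matrix (p + q) A = poly_matrix p A + poly_matrix q A"
  by (induction p q rule: poly_induct2) (auto simp: mat_add matrix_add_ldistrib)

lemma poly_matrix_sum: "poly_matrix (sum f S) A = (\<Sum>i\<in>S. poly_matrix (f i) A)"
  by (induction S rule: infinite_finite_induct) (auto simp: poly_matrix_add)

lemma poly_matrix_smult: "poly_matrix (smult c p) A = mat c ** poly_matrix p A"
  by (induction p) (auto simp: mat_mult_mat matrix_add_ldistrib mult_mat_assoc)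

lemma poly_matrix_mult: "poly_matrix (p * q) A = poly_matrix p A ** poly_matrix q A"
  by (induction p)
    (auto simp: poly_matrix_add poly_matrix_smult matrix_mult_add_right matrix_mul_assoc)

lemma poly_matrix_X: "poly_matrix [:- a, 1:] A = A - mat a"
  by (simp add: vec_eq_iff) (simp add: mat_def)

lemma poly_matrix_commute: "poly_matrix p A ** A = A ** poly_matrix p A"
proof -
  have "poly_matrix (p * [:0, 1:]) A = poly_matrix ([:0, 1:] * p) A" by (simp only: mult.commute)
  then show ?thesis by (simp add: poly_matrix_mult del: mult_pCons_left mult_pCons_right)
qed

lemma poly_matrix_power_X:
  "poly_matrix ([:- a, 1:] ^ N * q) A = (((**) (A - mat a)) ^^ N) (poly_matrix q A)"
  by (induction N) (simp_all only: power_Suc power_0 mult_1_left funpow.simps comp_apply id_apply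
      mult.assoc poly_matrix_mult[of "[:- a, 1:]"] poly_matrix_X)

text \<open>The matrices form a finite-dimensional real vector space, so that the powers of \<open>A\<close> satisfy a
  linear relation.\<close>

lemma ex_annihilating_polynomial:
  fixes A :: "complex^'n^'n"
  obtains p :: "complex poly" where "p \<noteq> 0" "poly_matrix p A = 0"
proof -
  define D where "D = DIM(complex^'n^'n)"
  define f where "f i = poly_matrix (monom 1 i) A" for i
  show ?thesis
  proof (cases "inj_on f {..D}")
    case True
    then have "dependent (f ` {..D})"
      by (intro dependent_biggerset) (simp add: card_image D_def)
    then obtain c i where c: "(\<Sum>v\<in>f ` {..D}. c v *\<^sub>R v) = 0" and i: "i \<le> D" "c (f i) \<noteq> 0"
      by (auto simp: dependent_finite)
    define p :: "complex poly" where "p = (\<Sum>i\<le>D. smult (of_real (c (f i))) (monom 1 i))"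
    have "poly_matrix p A = (\<Sum>i\<le>D. c (f i) *\<^sub>R f i)"
      unfolding p_def poly_matrix_sum poly_matrix_smult f_def
      by (intro sum.cong refl) (simp add: vec_eq_iff mat_mult_nth scaleR_conv_of_real[where 'a = complex])
    also have "\<dots> = 0" using c by (simp add: sum.reindex[OF True])
    finally have "poly_matrix p A = 0" .
    moreover have "coeff p i = of_real (c (f i))"
      using i by (simp add: p_def coeff_sum if_distrib[of "\<lambda>x. _ * x"] cong: if_cong)
    then have "p \<noteq> 0" using i(2) by auto
    ultimately show ?thesis using that by blast
  next
    case False
    then obtain i j where ij: "i \<noteq> j" "f i = f j" by (auto simp: inj_on_def)
    define p :: "complex poly" where "p = monom 1 i + smult (- 1) (monom 1 j)"
    have "poly_matrix p A = f i + mat (- 1) ** f j"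
      by (simp only: p_def poly_matrix_add poly_matrix_smult f_def)
    then have "poly_matrix p A = 0"
      using ij by (simp add: vec_eq_iff mat_mult_nth)
    moreover have "coeff p i = 1" using ij by (simp add: p_def)
    then have "p \<noteq> 0" by auto
    ultimately show ?thesis using that by blast
  qed
qed

text \<open>An invertible matrix can be cancelled, which removes all factors \<open>x\<close> from an annihilating
  polynomial.\<close>

lemma ex_annihilating_polynomial_invertible:
  fixes A :: "complex^'n^'n"
  assumes "invertible A"
  obtains p :: "complex poly" where "poly p 0 \<noteq> 0" "poly_matrix p A = 0"
proof -
  obtain p where p: "p \<noteq> 0" "poly_matrix p A = 0" by (rule ex_annihilating_polynomial)
  obtain q where q: "p = [:- 0, 1:] ^ order 0 p * q" "\<not> [:- 0, 1:] dvd q"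
    using order_decomp[OF p(1)] by blast
  have "(((**) A) ^^ N) (poly_matrix q A) = 0 \<Longrightarrow> poly_matrix q A = 0" for N
    by (induction N) (auto dest!: invertible_mult_left_cancel[OF assms, of _ 0, simplified])
  then have "poly_matrix q A = 0"
    using p(2) poly_matrix_power_X[of 0 "order 0 p" q A] q(1) by simp
  moreover have "poly q 0 \<noteq> 0" using q(2) by (simp add: poly_eq_0_iff_dvd)
  ultimately show ?thesis using that by blast
qed

lemma coprime_linear_poly:
  fixes a b :: complex
  assumes "a \<noteq> b"
  shows "coprime [:- a, 1:] [:- b, 1:]"
proof (rule coprimeI)
  fix d assume "d dvd [:- a, 1:]" "d dvd [:- b, 1:]"
  then have "d dvd [:- a, 1:] - [:- b, 1:]" by (rule dvd_diff)
  then have "d dvd [:b - a:]" by simp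
  moreover have "is_unit [:b - a:]"
    using assms by (simp add: is_unit_const_poly_iff dvd_field_iff)
  ultimately show "is_unit d" by (rule dvd_trans)
qed

text \<open>Induction on \<open>S\<close>: the product over \<open>S\<close> is coprime to the new element \<open>q c\<close>, and the Bezout
  identity \<open>u \<Prod>\<^sub>S + v q(c) = 1\<close> is combined with the one for \<open>S\<close>, multiplied by \<open>v q(c)\<close>.\<close>

lemma bezout_pairwise_coprime:
  fixes q :: "'i \<Rightarrow> 'a::euclidean_ring_gcd"
  assumes "finite S" "S \<noteq> {}" "\<And>a b. a \<in> S \<Longrightarrow> b \<in> S \<Longrightarrow> a \<noteq> b \<Longrightarrow> coprime (q a) (q b)"
  shows "\<exists>h. (\<Sum>a\<in>S. h a * (\<Prod>b\<in>S - {a}. q b)) = 1"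
  using assms
proof (induction S rule: finite_ne_induct)
  case (singleton c)
  show ?case by (rule exI[of _ "\<lambda>_. 1"]) simp
next
  case (insert c S)
  obtain h where h: "(\<Sum>a\<in>S. h a * (\<Prod>b\<in>S - {a}. q b)) = 1"
    using insert.IH insert.prems by blast
  have "coprime (prod q S) (q c)"
    using insert.hyps insert.prems by (intro prod_coprime_left) (metis insertCI)
  then obtain u v where uv: "u * prod q S + v * q c = 1"
    by (metis bezout_coefficients_fst_snd coprime_iff_gcd_eq_1)
  define h' where "h' a = (if a = c then u else v * h a)" for a
  have "(\<Sum>a\<in>insert c S. h' a * (\<Prod>b\<in>insert c S - {a}. q b)) =
    h' c * (\<Prod>b\<in>insert c S - {c}. q b) + (\<Sum>a\<in>S. h' a * (\<Prod>b\<in>insert c S - {a}. q b))"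
    using insert.hyps by simp
  also have "insert c S - {c} = S" using insert.hyps by auto
  also have "(\<Sum>a\<in>S. h' a * (\<Prod>b\<in>insert c S - {a}. q b)) =
    (\<Sum>a\<in>S. (v * q c) * (h a * (\<Prod>b\<in>S - {a}. q b)))"
  proof (intro sum.cong refl)
    fix a assume a: "a \<in> S"
    then have "insert c S - {a} = insert c (S - {a})" "a \<noteq> c" using insert.hyps by auto
    then show "h' a * (\<Prod>b\<in>insert c S - {a}. q b) = (v * q c) * (h a * (\<Prod>b\<in>S - {a}. q b))"
      using insert.hyps by (simp add: h'_def mult_ac)
  qed
  also have "\<dots> = v * q c" by (simp only: h mult_1_right flip: sum_distrib_left)
  also have "h' c * prod q S + v * q c = 1" using uv by (simp add: h'_def)
  finally show ?case by (rule exI[of _ h'])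
qed

text \<open>The decomposition of the space into generalized eigenspaces of an invertible matrix, given by its
  commuting projections \<open>P i\<close> and eigenvalues \<open>a i\<close>. Indexing the projections by a separate set
  lets a map \<open>\<tau>\<close> transport a resolution of \<open>A\<close> to one of \<open>\<tau>(A)\<close> by acting on the values of \<open>a\<close> and \<open>P\<close>.\<close>

definition spectral_resolution ::
    "complex^'n^'n \<Rightarrow> 'i set \<Rightarrow> ('i \<Rightarrow> complex) \<Rightarrow> ('i \<Rightarrow> complex^'n^'n) \<Rightarrow> bool" where
  "spectral_resolution A S a P \<longleftrightarrow>
     finite S \<and> sum P S = mat 1 \<and>
     (\<forall>i\<in>S. \<forall>j\<in>S. i \<noteq> j \<longrightarrow> P i ** P j = 0) \<and>
     (\<forall>i\<in>S. a i \<noteq> 0 \<and> P i ** A = A ** P i \<and> (\<exists>N. (((**) (A - mat (a i))) ^^ N) (P i) = 0))"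

text \<open>The polynomials \<open>\<Prod>\<^sub>b\<^sub>\<noteq>\<^sub>a (x - b)\<^sup>m\<^sup>(\<^sup>b\<^sup>)\<close>, for the roots \<open>a\<close> of an annihilating polynomial, generate the unit
  ideal. The summands of a representation of 1 by them, evaluated at \<open>A\<close>, are the projections.\<close>

lemma ex_spectral_resolution:
  fixes A :: "complex^'n^'n"
  assumes "invertible A"
  obtains S P where "spectral_resolution A S (\<lambda>a. a) P"
proof -
  obtain p where p: "poly p 0 \<noteq> 0" "poly_matrix p A = 0"
    by (rule ex_annihilating_polynomial_invertible[OF assms])
  define S where "S = {z. poly p z = 0}"
  define m where "m z = order z p" for z
  define q where "q = (\<Prod>b\<in>S. [:- b, 1:] ^ m b)"
  have p0: "p \<noteq> 0" using p(1) by auto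
  have fin: "finite S" unfolding S_def using p0 by (rule poly_roots_finite)
  have "smult (lead_coeff p) q = p"
    unfolding q_def S_def m_def by (rule complex_poly_decompose)
  then have "mat (lead_coeff p) ** poly_matrix q A = 0" using p(2) by (metis poly_matrix_smult)
  then have q: "poly_matrix q A = 0" using p0 by (simp add: mat_mult_inj)
  have "(mat 1 :: complex^'n^'n) $ i $ i = 1" for i by (simp add: mat_def)
  then have "mat 1 \<noteq> (0 :: complex^'n^'n)" by (metis zero_index zero_neq_one)
  then have "S \<noteq> {}" using q by (auto simp: q_def one_pCons)
  moreover have "coprime ([:- a, 1:] ^ m a) ([:- b, 1:] ^ m b)" if "a \<noteq> b" for a b
    using coprime_linear_poly[OF that] by (simp only: coprime_power_left_iff coprime_power_right_iff simp_thms)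
  ultimately obtain h where h: "(\<Sum>a\<in>S. h a * (\<Prod>b\<in>S - {a}. [:- b, 1:] ^ m b)) = 1"
    using bezout_pairwise_coprime[OF fin, of "\<lambda>a. [:- a, 1:] ^ m a"] by metis
  define g where "g a = h a * (\<Prod>b\<in>S - {a}. [:- b, 1:] ^ m b)" for a
  define P where "P a = poly_matrix (g a) A" for a
  have full: "[:- a, 1:] ^ m a * g a = h a * q" if "a \<in> S" for a
    unfolding g_def q_def using fin that by (simp add: prod.remove[of S a] mult_ac)
  have "spectral_resolution A S (\<lambda>a. a) P"
    unfolding spectral_resolution_def
  proof (intro conjI ballI impI exI)
    have "sum P S = poly_matrix (sum g S) A" by (simp add: P_def poly_matrix_sum)
    also have "\<dots> = mat 1" by (simp add: g_def h one_pCons)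
    finally show "sum P S = mat 1" .
    show "P a ** P b = 0" if ab: "a \<in> S" "b \<in> S" "a \<noteq> b" for a b
    proof -
      have "[:- a, 1:] ^ m a dvd (\<Prod>b\<in>S - {b}. [:- b, 1:] ^ m b)"
        using fin ab by (intro dvd_prodI) auto
      then have "[:- a, 1:] ^ m a * g a dvd g b * g a"
        unfolding g_def[of b] by (intro mult_dvd_mono dvd_mult dvd_refl)
      then obtain r where "g b * g a = [:- a, 1:] ^ m a * g a * r" by (auto elim: dvdE)
      then have "g a * g b = h a * r * q"
        using full[OF ab(1)] by (metis mult.assoc mult.commute)
      then show ?thesis unfolding P_def by (metis mult_zero_matrix(1) poly_matrix_mult q)
    qed
    fix a assume a: "a \<in> S"
    show "a \<noteq> 0" using a p(1) by (auto simp: S_def)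
    show "P a ** A = A ** P a" by (simp add: P_def poly_matrix_commute)
    show "(((**) (A - mat a)) ^^ m a) (P a) = 0"
      unfolding P_def by (subst poly_matrix_power_X[symmetric]) (simp add: full a poly_matrix_mult q)
  qed (rule fin)
  then show ?thesis using that by blast
qed

section \<open>Removing resonances by a gauge transformation\<close>

text \<open>Induction on the total nilpotency order \<open>i + j\<close>. The matrices \<open>(A - \<alpha>) V\<close> and \<open>V (B - \<beta>)\<close> satisfy
  the same equivariance with a smaller order, hence are eigenfunctions of the translation for
  \<open>\<alpha> / \<beta>\<close>. The defect \<open>V (\<theta> + \<omega>) - (\<alpha> / \<beta>) V \<theta>\<close> is a combination of them, so \<open>V\<close> is at worst a Jordan
  block of length 2, which is excluded by \<open>shift_semisimple\<close>.\<close>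

lemma shift_generalized_eigenmatrix:
  fixes V :: "real^'d \<Rightarrow> complex^'n^'n"
  assumes ri: "rationally_independent \<omega>" and "\<beta> \<noteq> 0"
    and "continuous_on UNIV V" "torus_periodic 1 V"
    and "\<And>\<theta>. V (\<theta> + \<omega>) ** B = A ** V \<theta>"
    and "\<And>\<theta>. (((**) (A - mat \<alpha>)) ^^ i) (V \<theta>) = 0"
    and "\<And>\<theta>. ((\<lambda>M. M ** (B - mat \<beta>)) ^^ j) (V \<theta>) = 0"
  shows "V (\<theta> + \<omega>) = mat (\<alpha> / \<beta>) ** V \<theta>"
  using assms(3-)
proof (induction "i + j" arbitrary: i j V \<theta> rule: less_induct)
  case less
  note V = less.prems
  show ?case
  proof (cases "i = 0 \<or> j = 0")
    case True
    then have "V \<theta> = 0" for \<theta> using V(4)[of \<theta>] V(5)[of \<theta>] by auto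
    then show ?thesis by simp
  next
    case False
    then obtain i' j' where ij: "i = Suc i'" "j = Suc j'" by (meson not0_implies_Suc)
    define L where "L \<theta> = (A - mat \<alpha>) ** V \<theta>" for \<theta>
    define R where "R \<theta> = V \<theta> ** (B - mat \<beta>)" for \<theta>
    have comm: "(A - mat \<alpha>) ** A = A ** (A - mat \<alpha>)" "(B - mat \<beta>) ** B = B ** (B - mat \<beta>)"
      by (simp_all add: matrix_mult_diff mat_commute)
    have L: "L (\<theta> + \<omega>) = mat (\<alpha> / \<beta>) ** L \<theta>" for \<theta>
    proof (rule less.hyps[of i' j])
      show "continuous_on UNIV L" unfolding L_def by (intro continuous_intros V)
      show "torus_periodic 1 L" using V(2) by (simp add: L_def torus_periodic_def)
      show "L (\<theta> + \<omega>) ** B = A ** L \<theta>" for \<theta>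
        unfolding L_def using V(3)[of \<theta>] comm(1) by (metis matrix_mul_assoc)
      show "(((**) (A - mat \<alpha>)) ^^ i') (L \<theta>) = 0" for \<theta>
        using V(4)[of \<theta>] by (simp add: ij L_def funpow_swap1)
      show "((\<lambda>M. M ** (B - mat \<beta>)) ^^ j) (L \<theta>) = 0" for \<theta>
        using funpow_intertwine[of "(**) (A - mat \<alpha>)" "\<lambda>M. M ** (B - mat \<beta>)"
            "\<lambda>M. M ** (B - mat \<beta>)" j "V \<theta>"] V(5)[of \<theta>]
        by (simp add: L_def matrix_mul_assoc)
    qed (simp add: ij)
    have R: "R (\<theta> + \<omega>) = mat (\<alpha> / \<beta>) ** R \<theta>" for \<theta>
    proof (rule less.hyps[of i j'])
      show "continuous_on UNIV R" unfolding R_def by (intro continuous_intros V)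
      show "torus_periodic 1 R" using V(2) by (simp add: R_def torus_periodic_def)
      show "R (\<theta> + \<omega>) ** B = A ** R \<theta>" for \<theta>
        unfolding R_def using V(3)[of \<theta>] comm(2) by (metis matrix_mul_assoc)
      show "((\<lambda>M. M ** (B - mat \<beta>)) ^^ j') (R \<theta>) = 0" for \<theta>
        using V(5)[of \<theta>] by (simp add: ij R_def funpow_Suc_right del: funpow.simps)
      show "(((**) (A - mat \<alpha>)) ^^ i) (R \<theta>) = 0" for \<theta>
        using funpow_intertwine[of "\<lambda>M. M ** (B - mat \<beta>)" "(**) (A - mat \<alpha>)"
            "(**) (A - mat \<alpha>)" i "V \<theta>"] V(4)[of \<theta>]
        by (simp add: R_def matrix_mul_assoc)
    qed (simp add: ij)
    have defect: "mat \<beta> ** V (\<theta> + \<omega>) - mat \<alpha> ** V \<theta> = L \<theta> - R (\<theta> + \<omega>)" for \<theta>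
      using V(3)[of \<theta>] by (simp add: L_def R_def matrix_mult_diff mat_commute)
    have defect': "V (\<theta> + \<omega>) $ r $ s - \<alpha> / \<beta> * V \<theta> $ r $ s = (L \<theta> $ r $ s - R (\<theta> + \<omega>) $ r $ s) / \<beta>"
      for \<theta> r s
      using arg_cong[OF defect[of \<theta>], of "\<lambda>M. M $ r $ s"] \<open>\<beta> \<noteq> 0\<close>
      by (simp add: mat_mult_nth field_simps)
    show ?thesis
    proof (simp add: vec_eq_iff mat_mult_nth del: times_divide_eq_left, intro allI)
      fix r s
      show "V (\<theta> + \<omega>) $ r $ s = \<alpha> / \<beta> * V \<theta> $ r $ s"
      proof (rule shift_semisimple[OF ri])
        show "continuous_on UNIV (\<lambda>\<theta>. V \<theta> $ r $ s)" by (intro continuous_intros V)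
        show "torus_periodic 1 (\<lambda>\<theta>. V \<theta> $ r $ s)" using V(2) by (simp add: torus_periodic_def)
        show "V (\<theta> + \<omega> + \<omega>) $ r $ s - \<alpha> / \<beta> * V (\<theta> + \<omega>) $ r $ s =
            \<alpha> / \<beta> * (V (\<theta> + \<omega>) $ r $ s - \<alpha> / \<beta> * V \<theta> $ r $ s)" for \<theta>
          unfolding defect' L R mat_mult_nth by (simp add: right_diff_distrib diff_divide_distrib)
      qed
    qed
  qed
qed

definition resolution_sum :: "'i set \<Rightarrow> ('i \<Rightarrow> complex) \<Rightarrow> ('i \<Rightarrow> complex^'n^'n) \<Rightarrow> complex^'n^'n" where
  "resolution_sum S c P = (\<Sum>i\<in>S. mat (c i) ** P i)"

text \<open>The change of coordinates that removes the resonances. As a function of \<open>\<theta>\<close> it is a homomorphism into the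
  matrices commuting with \<open>A\<close>, and it acts on the generalized eigenspace of \<open>a i\<close> as the character of
  frequency \<open>\<rho> (a i)\<close>.\<close>

definition torus_gauge ::
    "(complex \<Rightarrow> real^'d) \<Rightarrow> 'i set \<Rightarrow> ('i \<Rightarrow> complex) \<Rightarrow> ('i \<Rightarrow> complex^'n^'n) \<Rightarrow> real^'d \<Rightarrow> complex^'n^'n"
  where "torus_gauge \<rho> S a P \<theta> = resolution_sum S (\<lambda>i. character (\<rho> (a i)) \<theta>) P"

lemma resolution_idempotent:
  assumes "spectral_resolution A S a P" "i \<in> S"
  shows "P i ** P i = P i"
proof -
  have "P i = P i ** sum P S" using assms by (simp add: spectral_resolution_def)
  also have "\<dots> = (\<Sum>j\<in>S. P i ** P j)" by (simp add: matrix_mult_sum)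
  also have "\<dots> = (\<Sum>j\<in>S. if j = i then P i ** P i else 0)"
    using assms by (intro sum.cong) (auto simp: spectral_resolution_def)
  also have "\<dots> = P i ** P i" using assms by (simp add: spectral_resolution_def)
  finally show ?thesis by simp
qed

lemma resolution_sum_mult:
  assumes "spectral_resolution A S a P"
  shows "resolution_sum S c P ** resolution_sum S d P = resolution_sum S (\<lambda>i. c i * d i) P"
proof -
  have "resolution_sum S c P ** resolution_sum S d P =
      (\<Sum>i\<in>S. \<Sum>j\<in>S. mat (c i * d j) ** (P i ** P j))"
    unfolding resolution_sum_def
    by (simp add: matrix_mult_sum scaled_matrix_mult) (rule sum.swap)
  also have "\<dots> = (\<Sum>i\<in>S. \<Sum>j\<in>S. if j = i then mat (c i * d i) ** P i else 0)"
    using assms resolution_idempotent[OF assms]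
    by (intro sum.cong refl) (auto simp: spectral_resolution_def)
  also have "\<dots> = resolution_sum S (\<lambda>i. c i * d i) P"
    using assms by (simp add: spectral_resolution_def resolution_sum_def)
  finally show ?thesis .
qed

lemma gauge_add:
  assumes "spectral_resolution A S a P"
  shows "torus_gauge \<rho> S a P (\<theta> + \<eta>) = torus_gauge \<rho> S a P \<theta> ** torus_gauge \<rho> S a P \<eta>"
  by (simp add: torus_gauge_def resolution_sum_mult[OF assms] character_add)

lemma gauge_0:
  assumes "spectral_resolution A S a P"
  shows "torus_gauge \<rho> S a P 0 = mat 1"
  using assms by (simp add: torus_gauge_def resolution_sum_def spectral_resolution_def)

lemma gauge_inverse:
  assumes "spectral_resolution A S a P"
  shows "torus_gauge \<rho> S a P \<theta> ** torus_gauge \<rho> S a P (- \<theta>) = mat 1"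
    and "torus_gauge \<rho> S a P (- \<theta>) ** torus_gauge \<rho> S a P \<theta> = mat 1"
    and "invertible (torus_gauge \<rho> S a P \<theta>)"
    and "matrix_inv (torus_gauge \<rho> S a P \<theta>) = torus_gauge \<rho> S a P (- \<theta>)"
proof -
  show *: "torus_gauge \<rho> S a P \<theta> ** torus_gauge \<rho> S a P (- \<theta>) = mat 1"
    "torus_gauge \<rho> S a P (- \<theta>) ** torus_gauge \<rho> S a P \<theta> = mat 1"
    using gauge_add[OF assms, of \<rho> \<theta> "- \<theta>"] gauge_add[OF assms, of \<rho> "- \<theta>" \<theta>] gauge_0[OF assms, of \<rho>]
    by simp_all
  show "invertible (torus_gauge \<rho> S a P \<theta>)" using * unfolding invertible_def by blast
  show "matrix_inv (torus_gauge \<rho> S a P \<theta>) = torus_gauge \<rho> S a P (- \<theta>)" using * by (rule matrix_inv_unique)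
qed

lemma gauge_commute:
  assumes "spectral_resolution A S a P"
  shows "torus_gauge \<rho> S a P \<theta> ** A = A ** torus_gauge \<rho> S a P \<theta>"
  using assms unfolding torus_gauge_def resolution_sum_def spectral_resolution_def
  by (auto simp: matrix_mult_sum mult_mat_assoc simp flip: matrix_mul_assoc intro!: sum.cong)

lemma continuous_on_gauge: "continuous_on UNIV (torus_gauge \<rho> S a P)"
  unfolding torus_gauge_def resolution_sum_def by (intro continuous_intros)

lemma gauge_periodic:
  assumes "\<And>z. real N *\<^sub>R \<rho> z \<in> integer_vectors"
  shows "torus_periodic N (torus_gauge \<rho> S a P)"
  unfolding torus_periodic_def torus_gauge_def
proof (intro allI ballI)
  fix \<theta> k :: "real^'a" assume "k \<in> integer_vectors"
  then have "character (real N *\<^sub>R \<rho> z) k = 1" for z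
    by (intro character_integer_vectors assms)
  then have "character (\<rho> z) (real N *\<^sub>R k) = 1" for z by (simp add: character_def)
  then show "resolution_sum S (\<lambda>i. character (\<rho> (a i)) (\<theta> + real N *\<^sub>R k)) P =
      resolution_sum S (\<lambda>i. character (\<rho> (a i)) \<theta>) P"
    by (simp add: character_add)
qed

text \<open>By \<open>shift_generalized_eigenmatrix\<close> each entry of the block \<open>P i ** W \<theta> ** Q j\<close> is a multiple of a
  character with frequency \<open>k = \<rho> (a i) - \<rho> (b j)\<close>, and this is exactly the phase that the two gauges
  cancel.\<close>

lemma gauge_trivializes:
  fixes W :: "real^'d \<Rightarrow> complex^'n^'n"
  assumes ri: "rationally_independent \<omega>"
    and A: "spectral_resolution A S a P" and B: "spectral_resolution B T b Q"
    and cont: "continuous_on UNIV W" and per: "torus_periodic 1 W"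
    and rel: "\<And>\<theta>. W (\<theta> + \<omega>) ** B = A ** W \<theta>"
    and \<rho>: "resonance_index \<omega> \<rho>"
  shows "torus_gauge \<rho> S a P (- \<theta>) ** W \<theta> ** torus_gauge \<rho> T b Q \<theta> = W 0"
proof -
  have block: "mat (character (\<rho> (a i)) (- \<theta>) * character (\<rho> (b j)) \<theta>) ** (P i ** W \<theta> ** Q j) =
      P i ** W 0 ** Q j" if i: "i \<in> S" and j: "j \<in> T" for i j
  proof -
    define V where "V \<theta> = P i ** W \<theta> ** Q j" for \<theta>
    from A i obtain m where a0: "a i \<noteq> 0" and Pc: "P i ** A = A ** P i"
      and Pn: "(((**) (A - mat (a i))) ^^ m) (P i) = 0"
      unfolding spectral_resolution_def by blast
    from B j obtain n where b0: "b j \<noteq> 0" and Qc: "Q j ** B = B ** Q j"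
      and Qn: "(((**) (B - mat (b j))) ^^ n) (Q j) = 0"
      unfolding spectral_resolution_def by blast
    have Vc: "continuous_on UNIV V" unfolding V_def by (intro continuous_intros cont)
    have Vp: "torus_periodic 1 V" using per by (simp add: V_def torus_periodic_def)
    have V: "V (\<theta> + \<omega>) = mat (a i / b j) ** V \<theta>" for \<theta>
    proof (rule shift_generalized_eigenmatrix[OF ri b0 Vc Vp])
      show "V (\<theta> + \<omega>) ** B = A ** V \<theta>" for \<theta>
        unfolding V_def using rel[of \<theta>] Pc Qc by (metis matrix_mul_assoc)
      show "(((**) (A - mat (a i))) ^^ m) (V \<theta>) = 0" for \<theta>
        using funpow_intertwine[of "\<lambda>M. M ** (W \<theta> ** Q j)" "(**) (A - mat (a i))"
            "(**) (A - mat (a i))" m "P i"] Pn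
        by (simp add: V_def matrix_mul_assoc)
      show "((\<lambda>M. M ** (B - mat (b j))) ^^ n) (V \<theta>) = 0" for \<theta>
      proof -
        have QR: "((\<lambda>M. M ** (B - mat (b j))) ^^ n) (Q j) = (((**) (B - mat (b j))) ^^ n) (Q j)"
          by (rule funpow_mult_commute) (simp add: matrix_mult_diff Qc mat_commute)
        show ?thesis
          using funpow_intertwine[of "(**) (P i ** W \<theta>)" "\<lambda>M. M ** (B - mat (b j))"
              "\<lambda>M. M ** (B - mat (b j))" n "Q j"] Qn
          by (simp add: V_def matrix_mul_assoc QR)
      qed
    qed
    have "character (\<rho> (a i)) (- \<theta>) * character (\<rho> (b j)) \<theta> * V \<theta> $ r $ s = V 0 $ r $ s" for r s
    proof (cases "\<forall>\<theta>. V \<theta> $ r $ s = 0")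
      case False
      then obtain \<theta>0 where nz: "V \<theta>0 $ r $ s \<noteq> 0" by blast
      have "continuous_on UNIV (\<lambda>\<theta>. V \<theta> $ r $ s)" by (intro continuous_intros Vc)
      moreover have "torus_periodic 1 (\<lambda>\<theta>. V \<theta> $ r $ s)" using Vp by (simp add: torus_periodic_def)
      moreover have "V (\<theta> + \<omega>) $ r $ s = a i / b j * V \<theta> $ r $ s" for \<theta>
        unfolding V mat_mult_nth ..
      ultimately obtain k where k: "k \<in> integer_vectors" "a i / b j = character k \<omega>"
        "\<And>\<theta>. V \<theta> $ r $ s = V 0 $ r $ s * character k \<theta>"
        using nz by (rule shift_eigenfunction_is_character[OF ri]) blast
      have "a i = character k \<omega> * b j" using k(2) b0 by (metis nonzero_divide_eq_eq)
      then have "\<rho> (a i) = \<rho> (b j) + k" using \<rho> b0 k(1) by (simp add: resonance_index_def)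
      then have "character (\<rho> (a i)) (- \<theta>) * character (\<rho> (b j)) \<theta> * character k \<theta> = 1"
        unfolding character_minus character_uminus_left by (simp add: character_add_left field_simps)
      then show ?thesis by (subst k(3)) (simp add: mult_ac)
    qed simp
    then show ?thesis by (simp add: vec_eq_iff mat_mult_nth V_def)
  qed
  have "torus_gauge \<rho> S a P (- \<theta>) ** W \<theta> ** torus_gauge \<rho> T b Q \<theta> =
      (\<Sum>i\<in>S. \<Sum>j\<in>T. mat (character (\<rho> (a i)) (- \<theta>) * character (\<rho> (b j)) \<theta>) ** (P i ** W \<theta> ** Q j))"
    unfolding torus_gauge_def resolution_sum_def
    by (simp add: matrix_mult_sum scaled_matrix_mult3) (rule sum.swap)
  also have "\<dots> = (\<Sum>i\<in>S. \<Sum>j\<in>T. P i ** W 0 ** Q j)" by (intro sum.cong refl block)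
  also have "\<dots> = sum P S ** W 0 ** sum Q T" by (simp add: matrix_mult_sum) (rule sum.swap)
  also have "\<dots> = W 0" using A B by (simp add: spectral_resolution_def)
  finally show ?thesis .
qed

section \<open>Complex conjugation and duality with respect to a bilinear form\<close>

definition matrix_cnj :: "complex^'n^'n \<Rightarrow> complex^'n^'n" where
  "matrix_cnj = map_matrix cnj"

text \<open>The inverse of the adjoint with respect to the bilinear form with matrix \<open>F\<close>. Its fixed points
  are the isometries of the form.\<close>

definition form_dual :: "complex^'n^'n \<Rightarrow> complex^'n^'n \<Rightarrow> complex^'n^'n" where
  "form_dual F M = matrix_inv F ** (transpose (matrix_inv M) ** F)"

lemma matrix_cnj_mult: "matrix_cnj (M ** N) = matrix_cnj M ** matrix_cnj N"
  by (simp add: matrix_cnj_def vec_eq_iff matrix_matrix_mult_def)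

lemma matrix_cnj_mat: "matrix_cnj (mat c) = mat (cnj c)"
  by (simp add: matrix_cnj_def vec_eq_iff mat_def)

lemma matrix_cnj_add: "matrix_cnj (M + N) = matrix_cnj M + matrix_cnj N"
  by (simp add: matrix_cnj_def vec_eq_iff)

lemma matrix_cnj_sum: "matrix_cnj (sum f S) = (\<Sum>i\<in>S. matrix_cnj (f i))"
  by (induction S rule: infinite_finite_induct) (auto simp: matrix_cnj_def vec_eq_iff)

lemma transpose_sum: "transpose (sum f S) = (\<Sum>i\<in>S. transpose (f i))"
  by (induction S rule: infinite_finite_induct) (auto simp: transpose_def vec_eq_iff)

lemma invertible_transpose_iff: "invertible M \<Longrightarrow> invertible (transpose M)" for M :: "complex^'n^'n"
  unfolding invertible_def by (metis matrix_transpose_mul transpose_mat)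

lemma invertible_matrix_cnj: "invertible M \<Longrightarrow> invertible (matrix_cnj M)"
  unfolding invertible_def by (metis matrix_cnj_mult matrix_cnj_mat complex_cnj_one)

lemma continuous_on_matrix_cnj: "continuous_on S matrix_cnj"
  unfolding matrix_cnj_def map_matrix_def
  by (intro continuous_on_vec_lambda continuous_intros)

lemma continuous_on_transpose: "continuous_on S (transpose :: complex^'n^'n \<Rightarrow> complex^'n^'n)"
  unfolding transpose_def by (intro continuous_on_vec_lambda continuous_intros)

text \<open>Entrywise conjugation and similarity are of this kind; \<open>f\<close> is the effect of \<open>c\<close> on eigenvalues.\<close>

lemma spectral_resolution_hom:
  fixes c :: "complex^'n^'n \<Rightarrow> complex^'n^'n"
  assumes res: "spectral_resolution A S a P"
    and add: "\<And>M N. c (M + N) = c M + c N" and mult: "\<And>M N. c (M ** N) = c M ** c N"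
    and mat: "\<And>z. c (mat z) = mat (f z)" and f: "f 1 = 1" "\<And>z. z \<noteq> 0 \<Longrightarrow> f z \<noteq> 0"
  shows "spectral_resolution (c A) S (\<lambda>i. f (a i)) (\<lambda>i. c (P i))"
proof -
  have zero: "c 0 = 0" using add[of 0 0] by simp
  have diff: "c (M - N) = c M - c N" for M N using add[of "M - N" N] by simp
  have sum: "c (sum g S) = (\<Sum>i\<in>S. c (g i))" for g
    by (induction S rule: infinite_finite_induct) (simp_all add: zero add)
  have nil: "(((**) (c A - mat (f (a i)))) ^^ n) (c (P i)) = c ((((**) (A - mat (a i))) ^^ n) (P i))" for n i
    by (rule funpow_intertwine[symmetric]) (simp add: mult diff mat)
  show ?thesis
    unfolding spectral_resolution_def
  proof (intro conjI ballI impI)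
    show "finite S" using res by (simp add: spectral_resolution_def)
    show "(\<Sum>i\<in>S. c (P i)) = mat 1"
      using res mat[of 1] by (simp add: spectral_resolution_def f flip: sum)
    show "c (P i) ** c (P j) = 0" if "i \<in> S" "j \<in> S" "i \<noteq> j" for i j
      using res that by (simp add: spectral_resolution_def zero flip: mult)
    fix i assume i: "i \<in> S"
    show "f (a i) \<noteq> 0" using res i by (simp add: spectral_resolution_def f)
    show "c (P i) ** c A = c A ** c (P i)"
      using res i by (simp add: spectral_resolution_def flip: mult)
    obtain n where "(((**) (A - mat (a i))) ^^ n) (P i) = 0"
      using res i unfolding spectral_resolution_def by blast
    then show "\<exists>N. (((**) (c A - mat (f (a i)))) ^^ N) (c (P i)) = 0"
      using nil zero by metis
  qed
qed

lemma spectral_resolution_cnj: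
  assumes "spectral_resolution A S a P"
  shows "spectral_resolution (matrix_cnj A) S (\<lambda>i. cnj (a i)) (\<lambda>i. matrix_cnj (P i))"
  by (rule spectral_resolution_hom[OF assms])
    (simp_all add: matrix_cnj_add matrix_cnj_mult matrix_cnj_mat)

text \<open>Transposition reverses products. The projections commute with \<open>A\<close>, which allows the nilpotent
  factors to be put back on the left.\<close>

lemma spectral_resolution_transpose:
  fixes A :: "complex^'n^'n"
  assumes "spectral_resolution A S a P"
  shows "spectral_resolution (transpose A) S a (\<lambda>i. transpose (P i))"
proof -
  have nil: "(((**) (transpose A - mat (a i))) ^^ n) (transpose (P i)) =
      transpose ((((**) (A - mat (a i))) ^^ n) (P i))" if "i \<in> S" for n i
  proof -
    have "P i ** (A - mat (a i)) = (A - mat (a i)) ** P i"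
      using assms that by (simp add: spectral_resolution_def matrix_mult_diff mat_commute)
    then have "transpose ((((**) (A - mat (a i))) ^^ n) (P i)) =
        transpose (((\<lambda>M. M ** (A - mat (a i))) ^^ n) (P i))"
      by (simp add: funpow_mult_commute)
    also have "\<dots> = (((**) (transpose A - mat (a i))) ^^ n) (transpose (P i))"
    proof (rule funpow_intertwine)
      have "transpose (A - mat (a i)) = transpose A - mat (a i)"
        by (simp add: transpose_def vec_eq_iff mat_def)
      then show "transpose (M ** (A - mat (a i))) = (transpose A - mat (a i)) ** transpose M" for M
        by (simp add: matrix_transpose_mul)
    qed
    finally show ?thesis ..
  qed
  have t0: "transpose (0 :: complex^'n^'n) = 0" by (simp add: transpose_def vec_eq_iff)
  show ?thesis
    unfolding spectral_resolution_def
  proof (intro conjI ballI impI)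
    show "finite S" using assms by (simp add: spectral_resolution_def)
    show "(\<Sum>i\<in>S. transpose (P i)) = mat 1"
      using assms by (simp add: spectral_resolution_def flip: transpose_sum)
    show "transpose (P i) ** transpose (P j) = 0" if "i \<in> S" "j \<in> S" "i \<noteq> j" for i j
      using assms that by (simp add: spectral_resolution_def t0 flip: matrix_transpose_mul)
    fix i assume i: "i \<in> S"
    show "a i \<noteq> 0" using assms i by (simp add: spectral_resolution_def)
    show "transpose (P i) ** transpose A = transpose A ** transpose (P i)"
      using assms i by (simp add: spectral_resolution_def flip: matrix_transpose_mul)
    show "\<exists>N. (((**) (transpose A - mat (a i))) ^^ N) (transpose (P i)) = 0"
    proof -
      obtain n where "(((**) (A - mat (a i))) ^^ n) (P i) = 0"
        using assms i unfolding spectral_resolution_def by blast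
      then show ?thesis using nil[OF i, of n] t0 by auto
    qed
  qed
qed

text \<open>The nilpotency carries over because \<open>A\<^sup>-\<^sup>1 - a\<^sup>-\<^sup>1\<close> is the product of \<open>A - a\<close> and the matrix
  \<open>C = - a\<^sup>-\<^sup>1 A\<^sup>-\<^sup>1\<close>, which commutes with it.\<close>

lemma spectral_resolution_inverse:
  fixes A :: "complex^'n^'n"
  assumes "spectral_resolution A S a P" "invertible A"
  shows "spectral_resolution (matrix_inv A) S (\<lambda>i. inverse (a i)) P"
  unfolding spectral_resolution_def
proof (intro conjI ballI impI)
  show "finite S" "sum P S = mat 1" using assms by (simp_all add: spectral_resolution_def)
  show "P i ** P j = 0" if "i \<in> S" "j \<in> S" "i \<noteq> j" for i j
    using assms that by (simp add: spectral_resolution_def)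
  fix i assume i: "i \<in> S"
  show "inverse (a i) \<noteq> 0" using assms i by (simp add: spectral_resolution_def)
  have a: "a i \<noteq> 0" and comm: "P i ** A = A ** P i"
    using assms i by (simp_all add: spectral_resolution_def)
  have "matrix_inv A ** (P i ** A) ** matrix_inv A = matrix_inv A ** (A ** P i) ** matrix_inv A"
    by (simp add: comm)
  then show "P i ** matrix_inv A = matrix_inv A ** P i"
    using assms(2) by (simp add: matrix_inv_cancel matrix_inv_right flip: matrix_mul_assoc)
  define C where "C = mat (- inverse (a i)) ** matrix_inv A"
  define M where "M = A - mat (a i)"
  have M: "matrix_inv A ** M = mat 1 - mat (a i) ** matrix_inv A"
    "M ** matrix_inv A = mat 1 - mat (a i) ** matrix_inv A"
    using assms(2) by (simp_all add: M_def matrix_mult_diff matrix_inv_left matrix_inv_right mat_commute)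
  have CM': "C ** M = mat (- inverse (a i)) ** (mat 1 - mat (a i) ** matrix_inv A)"
    unfolding C_def matrix_mul_assoc[symmetric] M ..
  have CM: "C ** M = M ** C"
    unfolding CM' unfolding C_def mult_mat_assoc M ..
  have "mat (inverse (a i)) $ r $ s = inverse (a i) * (mat 1 :: complex^'n^'n) $ r $ s" for r s
    by (simp add: mat_def)
  then have X: "matrix_inv A - mat (inverse (a i)) = C ** M"
    unfolding CM' by (simp only: vec_eq_iff vector_minus_component mat_mult_nth) (simp add: a algebra_simps)
  have "(((**) M) ^^ n) Y = 0 \<Longrightarrow> (((**) (C ** M)) ^^ n) Y = 0" for n Y
  proof (induction n arbitrary: Y)
    case (Suc n)
    have "(((**) M) ^^ n) (C ** M ** Y) = (((**) M) ^^ Suc n) (C ** Y)"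
      by (simp add: funpow_Suc_right CM matrix_mul_assoc del: funpow.simps)
    also have "\<dots> = C ** (((**) M) ^^ Suc n) Y"
      by (rule funpow_intertwine[symmetric]) (simp add: CM matrix_mul_assoc)
    finally have "(((**) (C ** M)) ^^ n) (C ** M ** Y) = 0"
      using Suc by (metis mult_zero_matrix(1))
    then show ?case by (simp add: funpow_Suc_right del: funpow.simps)
  qed simp
  then show "\<exists>N. (((**) (matrix_inv A - mat (inverse (a i)))) ^^ N) (P i) = 0"
    using assms(1) i unfolding spectral_resolution_def X M_def by blast
qed

lemma spectral_resolution_similar:
  fixes A F :: "complex^'n^'n"
  assumes "spectral_resolution A S a P" "invertible F"
  shows "spectral_resolution (matrix_inv F ** (A ** F)) S a (\<lambda>i. matrix_inv F ** (P i ** F))"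
  using matrix_inv_cancel[OF assms(2)] matrix_inv_left[OF assms(2)]
  by (intro spectral_resolution_hom[OF assms(1), where f = "\<lambda>z. z"])
    (simp_all add: matrix_mult_add_right matrix_add_ldistrib mult_mat_assoc flip: matrix_mul_assoc)

text \<open>What the reduction needs to know about a map \<open>\<tau>\<close>. The last clause says that \<open>\<tau>\<close> sends the gauge of
  \<open>A\<close> to the gauge of \<open>\<tau> A\<close> with respect to the same index \<open>\<rho>\<close>; it is a condition on the behaviour of
  \<open>\<rho>\<close> under the action of \<open>\<tau>\<close> on eigenvalues. The index set is fixed to be complex as the
  eigenvalues themselves serve as indices.\<close>

definition gauge_compatible ::
    "(complex \<Rightarrow> real^'d) \<Rightarrow> (complex^'n^'n \<Rightarrow> complex^'n^'n) \<Rightarrow> bool" where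
  "gauge_compatible \<rho> \<tau> \<longleftrightarrow>
     (\<forall>M N. invertible M \<longrightarrow> invertible N \<longrightarrow> \<tau> (M ** N) = \<tau> M ** \<tau> N) \<and>
     (\<forall>M. invertible M \<longrightarrow> invertible (\<tau> M)) \<and>
     continuous_on {M. invertible M} \<tau> \<and>
     (\<forall>A S a P. invertible A \<longrightarrow> spectral_resolution A (S :: complex set) a P \<longrightarrow>
        (\<exists>b Q. spectral_resolution (\<tau> A) S b Q \<and> (\<forall>\<theta>. torus_gauge \<rho> S b Q \<theta> = \<tau> (torus_gauge \<rho> S a P \<theta>))))"

lemma gauge_compatible_cnj:
  fixes \<rho> :: "complex \<Rightarrow> real^'d"
  assumes "\<And>z. \<rho> (cnj z) = - \<rho> z"
  shows "gauge_compatible \<rho> (matrix_cnj :: complex^'n^'n \<Rightarrow> _)"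
  unfolding gauge_compatible_def
proof (intro conjI allI impI)
  fix A :: "complex^'n^'n" and S :: "complex set" and a P
  assume res: "spectral_resolution A S a P"
  have "torus_gauge \<rho> S (\<lambda>i. cnj (a i)) (\<lambda>i. matrix_cnj (P i)) \<theta> = matrix_cnj (torus_gauge \<rho> S a P \<theta>)" for \<theta>
    by (simp add: torus_gauge_def resolution_sum_def matrix_cnj_sum matrix_cnj_mult matrix_cnj_mat
        cnj_character assms)
  then show "\<exists>b Q. spectral_resolution (matrix_cnj A) S b Q \<and>
      (\<forall>\<theta>. torus_gauge \<rho> S b Q \<theta> = matrix_cnj (torus_gauge \<rho> S a P \<theta>))"
    by (intro exI conjI allI) (rule spectral_resolution_cnj[OF res])
qed (simp_all add: matrix_cnj_mult invertible_matrix_cnj continuous_on_matrix_cnj)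

lemma form_dual_mult:
  assumes "invertible F" "invertible M" "invertible N"
  shows "form_dual F (M ** N) = form_dual F M ** form_dual F N"
  by (simp add: form_dual_def matrix_inv_mult matrix_transpose_mul matrix_inv_cancel assms
      flip: matrix_mul_assoc)

lemma invertible_form_dual: "invertible F \<Longrightarrow> invertible M \<Longrightarrow> invertible (form_dual F M)"
  by (simp add: form_dual_def invertible_mult invertible_matrix_inv invertible_transpose_iff)

lemma continuous_on_form_dual: "continuous_on {M. invertible M} (form_dual F)"
  unfolding form_dual_def
  by (intro continuous_intros continuous_on_compose2[OF continuous_on_transpose continuous_on_matrix_inv]) auto

lemma spectral_resolution_form_dual:
  fixes A F :: "complex^'n^'n"
  assumes "invertible F" "invertible A" "spectral_resolution A S a P"
  shows "spectral_resolution (form_dual F A) S (\<lambda>i. inverse (a i)) (\<lambda>i. matrix_inv F ** (transpose (P i) ** F))"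
  unfolding form_dual_def
  by (intro spectral_resolution_similar spectral_resolution_transpose spectral_resolution_inverse assms)

lemma form_dual_gauge:
  fixes A F :: "complex^'n^'n"
  assumes "spectral_resolution A S a P"
  shows "form_dual F (torus_gauge \<rho> S a P \<theta>) =
    resolution_sum S (\<lambda>i. character (- \<rho> (a i)) \<theta>) (\<lambda>i. matrix_inv F ** (transpose (P i) ** F))"
  unfolding form_dual_def gauge_inverse(4)[OF assms]
  by (simp add: torus_gauge_def resolution_sum_def transpose_sum matrix_mult_sum matrix_transpose_mul
      character_minus mat_commute mult_mat_assoc flip: matrix_mul_assoc)

lemma gauge_compatible_form_dual:
  fixes \<rho> :: "complex \<Rightarrow> real^'d" and F :: "complex^'n^'n"
  assumes "\<And>z. z \<noteq> 0 \<Longrightarrow> \<rho> (inverse z) = - \<rho> z" "invertible F"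
  shows "gauge_compatible \<rho> (form_dual F)"
  unfolding gauge_compatible_def
proof (intro conjI allI impI)
  fix A :: "complex^'n^'n" and S :: "complex set" and a P
  assume A: "invertible A" and res: "spectral_resolution A S a P"
  have "torus_gauge \<rho> S (\<lambda>i. inverse (a i)) (\<lambda>i. matrix_inv F ** (transpose (P i) ** F)) \<theta> =
      form_dual F (torus_gauge \<rho> S a P \<theta>)" for \<theta>
    unfolding form_dual_gauge[OF res] unfolding torus_gauge_def resolution_sum_def
    using res by (intro sum.cong refl) (simp add: assms(1) spectral_resolution_def)
  then show "\<exists>b Q. spectral_resolution (form_dual F A) S b Q \<and>
      (\<forall>\<theta>. torus_gauge \<rho> S b Q \<theta> = form_dual F (torus_gauge \<rho> S a P \<theta>))"
    by (intro exI conjI allI) (rule spectral_resolution_form_dual[OF assms(2) A res])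
qed (simp_all add: form_dual_mult invertible_form_dual continuous_on_form_dual assms(2))

text \<open>Conjugation and duality both reverse the sign of the frequencies, so their composite preserves
  them, and \<open>\<rho>\<close> has to be invariant rather than odd.\<close>

lemma gauge_compatible_unitary:
  fixes \<rho> :: "complex \<Rightarrow> real^'d"
  assumes "\<And>z. z \<noteq> 0 \<Longrightarrow> \<rho> (inverse (cnj z)) = \<rho> z"
  shows "gauge_compatible \<rho> (\<lambda>M :: complex^'n^'n. matrix_cnj (form_dual (mat 1) M))"
  unfolding gauge_compatible_def
proof (intro conjI allI impI)
  fix A :: "complex^'n^'n" and S :: "complex set" and a P
  assume A: "invertible A" and res: "spectral_resolution A S a P"
  have \<rho>: "\<rho> (inverse (cnj (a i))) = \<rho> (a i)" if "i \<in> S" for i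
    using res that by (simp add: assms spectral_resolution_def)
  let ?Q = "\<lambda>i. matrix_inv (mat 1) ** (transpose (P i) ** mat 1)"
  have "torus_gauge \<rho> S (\<lambda>i. cnj (inverse (a i))) (\<lambda>i. matrix_cnj (?Q i)) \<theta> =
      matrix_cnj (form_dual (mat 1) (torus_gauge \<rho> S a P \<theta>))" for \<theta>
    unfolding form_dual_gauge[OF res] unfolding torus_gauge_def resolution_sum_def matrix_cnj_sum
    by (intro sum.cong refl)
      (simp only: matrix_cnj_mult matrix_cnj_mat cnj_character complex_cnj_inverse minus_minus \<rho>)
  then show "\<exists>b Q. spectral_resolution (matrix_cnj (form_dual (mat 1) A)) S b Q \<and>
      (\<forall>\<theta>. torus_gauge \<rho> S b Q \<theta> = matrix_cnj (form_dual (mat 1) (torus_gauge \<rho> S a P \<theta>)))"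
    by (intro exI conjI allI)
      (rule spectral_resolution_cnj[OF spectral_resolution_form_dual[OF invertible_mat_1 A res]])
next
  show "continuous_on {M. invertible M} (\<lambda>M :: complex^'n^'n. matrix_cnj (form_dual (mat 1) M))"
    by (rule continuous_on_compose2[OF continuous_on_matrix_cnj continuous_on_form_dual]) auto
qed (simp_all add: form_dual_mult invertible_form_dual invertible_mat_1 matrix_cnj_mult invertible_matrix_cnj)

section \<open>Reduction inside a group of fixed points\<close>

text \<open>The function \<open>Y\<close> is \<open>Z(0)\<^sup>-\<^sup>1 K(-\<theta>) Z \<theta>\<close>. For each \<open>\<tau>\<close>, \<open>gauge_trivializes\<close> applies to
  \<open>W = Z \<tau>(Z)\<^sup>-\<^sup>1\<close> and shows that \<open>Z' \<tau>(Z')\<^sup>-\<^sup>1\<close> is constant for \<open>Z' \<theta> = K(-\<theta>) Z \<theta>\<close>; normalizing \<open>Z'\<close> at the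
  origin turns this into \<open>\<tau>(Y) = Y\<close>. Since \<open>Y\<close> is independent of \<open>\<tau>\<close>, several maps can be treated at once.\<close>

lemma gauge_normal_form:
  fixes \<omega> :: "real^'d" and Z :: "real^'d \<Rightarrow> complex^'n^'n" and X :: "real^'d \<Rightarrow> complex^'n^'n"
  assumes ri: "rationally_independent \<omega>"
    and \<rho>: "resonance_index \<omega> \<rho>"
    and \<rho>N: "\<And>z. real N *\<^sub>R \<rho> z \<in> integer_vectors"
    and Zc: "continuous_on UNIV Z" and Zp: "torus_periodic 1 Z" and Zi: "\<And>\<theta>. invertible (Z \<theta>)"
    and Ai: "invertible A" and Xi: "\<And>\<theta>. invertible (X \<theta>)"
    and rel: "\<And>\<theta>. Z (\<theta> + \<omega>) ** X \<theta> = A ** Z \<theta>"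
  obtains Y :: "real^'d \<Rightarrow> complex^'n^'n" and B where "continuous_on UNIV Y" "torus_periodic N Y" "\<forall>\<theta>. invertible (Y \<theta>)" "Y 0 = mat 1"
    "\<forall>\<theta>. Y (\<theta> + \<omega>) ** X \<theta> = B ** Y \<theta>"
    "\<forall>\<tau>. gauge_compatible \<rho> \<tau> \<longrightarrow> (\<forall>\<theta>. \<tau> (X \<theta>) = X \<theta>) \<longrightarrow> (\<forall>\<theta>. \<tau> (Y \<theta>) = Y \<theta>)"
proof -
  obtain S P where res: "spectral_resolution A S (\<lambda>a. a) P"
    by (rule ex_spectral_resolution[OF Ai])
  define K where "K = torus_gauge \<rho> S (\<lambda>a. a) P"
  define Z' where "Z' \<theta> = K (- \<theta>) ** Z \<theta>" for \<theta>
  define Y where "Y \<theta> = matrix_inv (Z 0) ** Z' \<theta>" for \<theta>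
  define B where "B = matrix_inv (Z 0) ** (A ** (K (- \<omega>) ** Z 0))"
  have Kc: "continuous_on UNIV K" by (simp add: K_def continuous_on_gauge)
  have Kp: "torus_periodic N K" unfolding K_def by (rule gauge_periodic[OF \<rho>N])
  have Ki: "invertible (K \<theta>)" for \<theta> by (simp add: K_def gauge_inverse(3)[OF res])
  have K0: "K 0 = mat 1" by (simp add: K_def gauge_0[OF res])
  have Z'i: "invertible (Z' \<theta>)" for \<theta> by (simp add: Z'_def invertible_mult Ki Zi)
  have Yc: "continuous_on UNIV Y"
    unfolding Y_def Z'_def by (intro continuous_intros Zc continuous_on_compose2[OF Kc]) auto
  have Yp: "torus_periodic N Y"
    unfolding torus_periodic_def
  proof (intro allI ballI)
    fix \<theta> k :: "real^'d" assume k: "k \<in> integer_vectors"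
    then have "real N *\<^sub>R k \<in> integer_vectors" by (auto simp: integer_vectors_def)
    then have "Z (\<theta> + real N *\<^sub>R k) = Z \<theta>"
      using Zp unfolding torus_periodic_def by (metis of_nat_1 scaleR_one)
    moreover have "K (- \<theta> + real N *\<^sub>R (- k)) = K (- \<theta>)"
      using Kp integer_vectors_minus[OF k] unfolding torus_periodic_def by blast
    ultimately show "Y (\<theta> + real N *\<^sub>R k) = Y \<theta>"
      by (simp add: Y_def Z'_def)
  qed
  have Yi: "invertible (Y \<theta>)" for \<theta> by (simp add: Y_def invertible_mult invertible_matrix_inv Zi Z'i)
  have Y0: "Y 0 = mat 1" by (simp add: Y_def Z'_def K0 matrix_inv_left Zi)
  have Yrel: "Y (\<theta> + \<omega>) ** X \<theta> = B ** Y \<theta>" for \<theta>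
  proof -
    have "K (- (\<theta> + \<omega>)) = K (- \<omega>) ** K (- \<theta>)"
      using gauge_add[OF res, of \<rho> "- \<omega>" "- \<theta>"] by (simp only: K_def minus_add)
    moreover have "K \<theta> ** A = A ** K \<theta>" for \<theta> unfolding K_def by (rule gauge_commute[OF res])
    ultimately have "K (- (\<theta> + \<omega>)) ** A = A ** (K (- \<omega>) ** K (- \<theta>))"
      by (metis matrix_mul_assoc)
    then have "Z' (\<theta> + \<omega>) ** X \<theta> = A ** (K (- \<omega>) ** Z' \<theta>)"
      unfolding Z'_def using rel[of \<theta>] by (metis matrix_mul_assoc)
    then show ?thesis
      by (simp add: Y_def B_def matrix_inv_cancel Zi flip: matrix_mul_assoc)
  qed
  have "\<tau> (Y \<theta>) = Y \<theta>" if \<tau>: "gauge_compatible \<rho> \<tau>" and fix_X: "\<And>\<theta>. \<tau> (X \<theta>) = X \<theta>" for \<tau> \<theta>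
  proof -
    have mult: "\<tau> (M ** N) = \<tau> M ** \<tau> N" if "invertible M" "invertible N" for M N
      using \<tau> that by (simp add: gauge_compatible_def)
    have inv: "invertible (\<tau> M)" if "invertible M" for M
      using \<tau> that by (simp add: gauge_compatible_def)
    have one: "\<tau> (mat 1) = mat 1"
      using mult[OF invertible_mat_1 invertible_mat_1] inv[OF invertible_mat_1]
        invertible_mult_left_cancel[of "\<tau> (mat 1)" "\<tau> (mat 1)" "mat 1"] by simp
    obtain b Q where res': "spectral_resolution (\<tau> A) S b Q"
      and K': "\<And>\<theta>. torus_gauge \<rho> S b Q \<theta> = \<tau> (K \<theta>)"
      using \<tau> Ai res unfolding gauge_compatible_def K_def by blast
    \<comment> \<open>Since \<open>\<tau>\<close> is multiplicative, this is \<open>Z \<tau>(Z)\<^sup>-\<^sup>1\<close>, written without inverting a value of \<open>\<tau>\<close>.\<close>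
    define W where "W \<theta> = Z \<theta> ** \<tau> (matrix_inv (Z \<theta>))" for \<theta>
    have Wc: "continuous_on UNIV W"
    proof -
      have inv_cont: "continuous_on UNIV (\<lambda>\<theta>. matrix_inv (Z \<theta>))"
        by (rule continuous_on_compose2[OF continuous_on_matrix_inv Zc]) (auto simp: Zi)
      have "continuous_on {M. invertible M} \<tau>" using \<tau> by (simp add: gauge_compatible_def)
      from continuous_on_compose2[OF this inv_cont]
      have "continuous_on UNIV (\<lambda>\<theta>. \<tau> (matrix_inv (Z \<theta>)))"
        by (simp add: image_subset_iff invertible_matrix_inv Zi)
      then show ?thesis unfolding W_def by (intro continuous_intros Zc)
    qed
    have Wp: "torus_periodic 1 W" using Zp by (simp add: W_def torus_periodic_def)
    have Wrel: "W (\<theta> + \<omega>) ** \<tau> A = A ** W \<theta>" for \<theta>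
    proof -
      have "matrix_inv (Z (\<theta> + \<omega>)) ** A = X \<theta> ** matrix_inv (Z \<theta>)"
      proof -
        have "matrix_inv (Z (\<theta> + \<omega>)) ** (Z (\<theta> + \<omega>) ** X \<theta>) ** matrix_inv (Z \<theta>) =
            matrix_inv (Z (\<theta> + \<omega>)) ** (A ** Z \<theta>) ** matrix_inv (Z \<theta>)" by (simp add: rel)
        then show ?thesis
          by (simp add: matrix_inv_cancel matrix_inv_right Zi flip: matrix_mul_assoc)
      qed
      then have "\<tau> (matrix_inv (Z (\<theta> + \<omega>)) ** A) = \<tau> (X \<theta> ** matrix_inv (Z \<theta>))" by simp
      then have "\<tau> (matrix_inv (Z (\<theta> + \<omega>))) ** \<tau> A = X \<theta> ** \<tau> (matrix_inv (Z \<theta>))"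
        by (simp add: mult invertible_matrix_inv Zi Ai Xi fix_X)
      then show ?thesis unfolding W_def using rel[of \<theta>] by (metis matrix_mul_assoc)
    qed
    have const: "K (- \<theta>) ** W \<theta> ** \<tau> (K \<theta>) = W 0" for \<theta>
      using gauge_trivializes[OF ri res res' Wc Wp Wrel \<rho>] by (simp add: K_def K')
    have "\<tau> (matrix_inv (Z \<theta>)) ** \<tau> (K \<theta>) = \<tau> (matrix_inv (Z' \<theta>))" for \<theta>
    proof -
      have "matrix_inv (K (- \<theta>)) = K \<theta>" unfolding K_def by (simp add: gauge_inverse(4)[OF res])
      then have "matrix_inv (Z' \<theta>) = matrix_inv (Z \<theta>) ** K \<theta>"
        by (simp add: Z'_def matrix_inv_mult Ki Zi)
      then show ?thesis by (simp add: mult invertible_matrix_inv Zi Ki)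
    qed
    then have "Z' \<theta> ** \<tau> (matrix_inv (Z' \<theta>)) = Z 0 ** \<tau> (matrix_inv (Z 0))"
      using const[of \<theta>] unfolding W_def Z'_def by (metis matrix_mul_assoc)
    then have "matrix_inv (Z 0) ** (Z' \<theta> ** \<tau> (matrix_inv (Z' \<theta>))) ** \<tau> (Z' \<theta>) =
        matrix_inv (Z 0) ** (Z 0 ** \<tau> (matrix_inv (Z 0))) ** \<tau> (Z' \<theta>)" by simp
    moreover have "\<tau> (matrix_inv (Z' \<theta>)) ** \<tau> (Z' \<theta>) = mat 1"
      by (simp add: matrix_inv_left Z'i one invertible_matrix_inv flip: mult)
    ultimately have "Y \<theta> = \<tau> (matrix_inv (Z 0)) ** \<tau> (Z' \<theta>)"
      by (simp add: Y_def matrix_inv_cancel Zi flip: matrix_mul_assoc)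
    also have "\<dots> = \<tau> (Y \<theta>)"
      unfolding Y_def by (rule mult[symmetric]) (simp_all add: invertible_matrix_inv Zi Z'i)
    finally show ?thesis ..
  qed
  then show ?thesis using that Yc Yp Yi Y0 Yrel by blast
qed

lemma matrix_zpow_add_1:
  assumes "invertible A"
  shows "matrix_zpow A (m + 1) = A ** matrix_zpow A m"
proof (cases "m \<ge> 0")
  case True
  then have "nat (m + 1) = Suc (nat m)" by simp
  then show ?thesis using True by (simp add: matrix_zpow_def)
next
  case False
  then have s: "nat (- m) = Suc (nat (- (m + 1)))" by simp
  show ?thesis
  proof (cases "m = - 1")
    case True
    then show ?thesis by (simp add: matrix_zpow_def matrix_inv_right assms)
  next
    case m: False
    then have "\<not> m + 1 \<ge> 0" using False by simp
    then show ?thesis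
      using False by (simp add: matrix_zpow_def s matrix_inv_cancel assms)
  qed
qed

lemma matrix_zpow_1: "matrix_zpow A 1 = A"
  by (simp add: matrix_zpow_def)

text \<open>A cocycle over the integers is determined by its generator, so that it suffices to conjugate
  \<open>X 1\<close> to a constant.\<close>

lemma reducible_mod_of_conjugacy:
  fixes X :: "int \<Rightarrow> real^'d \<Rightarrow> complex^'n^'n"
  assumes cocycle: "discrete_cocycle \<omega> G X" and G: "\<And>M. M \<in> G \<Longrightarrow> invertible M"
    and Y: "continuous_on UNIV Y" "torus_periodic N Y" "\<And>\<theta>. Y \<theta> \<in> G" and B: "B \<in> G"
    and rel: "\<And>\<theta>. Y (\<theta> + \<omega>) ** X 1 \<theta> = B ** Y \<theta>"
  shows "reducible_mod N \<omega> G X"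
proof -
  have X_add: "X (m + m') \<theta> = X m (\<theta> + of_int m' *\<^sub>R \<omega>) ** X m' \<theta>" for m m' \<theta>
    using cocycle unfolding discrete_cocycle_def by blast
  have Xi: "invertible (X m \<theta>)" for m \<theta>
    using cocycle G unfolding discrete_cocycle_def by blast
  have Bi: "invertible B" and Yi: "invertible (Y \<theta>)" for \<theta>
    using B Y G by auto
  have X0: "X 0 \<theta> = mat 1" for \<theta>
    using X_add[of 0 0 \<theta>] invertible_mult_left_cancel[OF Xi, of 0 \<theta> "X 0 \<theta>" "mat 1"] by simp
  have step: "Y (\<theta> + of_int (m + 1) *\<^sub>R \<omega>) ** X (m + 1) \<theta> = B ** (Y (\<theta> + of_int m *\<^sub>R \<omega>) ** X m \<theta>)" for m \<theta>
  proof -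
    have "X (m + 1) \<theta> = X 1 (\<theta> + of_int m *\<^sub>R \<omega>) ** X m \<theta>"
      using X_add[of 1 m \<theta>] by (simp add: add.commute)
    moreover have "\<theta> + of_int (m + 1) *\<^sub>R \<omega> = (\<theta> + of_int m *\<^sub>R \<omega>) + \<omega>"
      by (simp add: algebra_simps)
    ultimately show ?thesis by (simp only: rel matrix_mul_assoc)
  qed
  have pow: "Y (\<theta> + of_int m *\<^sub>R \<omega>) ** X m \<theta> = matrix_zpow B m ** Y \<theta>" for m \<theta>
  proof (induction m rule: int_induct[of _ 0])
    case base
    then show ?case by (simp add: X0 matrix_zpow_def)
  next
    case (step1 i)
    then show ?case by (simp only: step matrix_zpow_add_1[OF Bi]) (simp add: matrix_mul_assoc)
  next
    case (step2 i)
    have "B ** (Y (\<theta> + of_int (i - 1) *\<^sub>R \<omega>) ** X (i - 1) \<theta>) = B ** (matrix_zpow B (i - 1) ** Y \<theta>)"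
      using step2(2) step[of \<theta> "i - 1"] matrix_zpow_add_1[OF Bi, of "i - 1"]
      by (simp add: matrix_mul_assoc)
    then show ?case by (rule invertible_mult_left_cancel[OF Bi])
  qed
  have "X m \<theta> = matrix_inv (Y (\<theta> + of_int m *\<^sub>R \<omega>)) ** matrix_zpow B m ** Y \<theta>" for m \<theta>
    using arg_cong[OF pow[of \<theta> m], of "(**) (matrix_inv (Y (\<theta> + of_int m *\<^sub>R \<omega>)))"]
    by (simp add: matrix_inv_cancel Yi flip: matrix_mul_assoc)
  then show ?thesis unfolding reducible_mod_def using Y B by blast
qed

lemma reducible_mod_generator:
  fixes X :: "int \<Rightarrow> real^'d \<Rightarrow> complex^'n^'n"
  assumes "reducible_mod N \<omega> GL_complex X"
  obtains Z :: "real^'d \<Rightarrow> complex^'n^'n" and A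
  where "continuous_on UNIV Z" "torus_periodic N Z" "\<And>\<theta>. invertible (Z \<theta>)" "invertible A"
    "\<And>\<theta>. Z (\<theta> + \<omega>) ** X 1 \<theta> = A ** Z \<theta>"
proof -
  obtain Z :: "real^'d \<Rightarrow> complex^'n^'n" and A
    where Z: "continuous_on UNIV Z" "torus_periodic N Z" "\<And>\<theta>. invertible (Z \<theta>)" "invertible A"
      and X: "\<And>m \<theta>. X m \<theta> = matrix_inv (Z (\<theta> + of_int m *\<^sub>R \<omega>)) ** matrix_zpow A m ** Z \<theta>"
    using assms unfolding reducible_mod_def GL_complex_def by auto
  have "Z (\<theta> + \<omega>) ** X 1 \<theta> = A ** Z \<theta>" for \<theta>
    by (simp add: X matrix_zpow_1 matrix_inv_cancel Z flip: matrix_mul_assoc)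
  then show ?thesis using that Z by blast
qed

definition fixed_group :: "(complex^'n^'n \<Rightarrow> complex^'n^'n) set \<Rightarrow> (complex^'n^'n) set" where
  "fixed_group T = {M. invertible M \<and> (\<forall>\<tau>\<in>T. \<tau> M = M)}"

text \<open>The constant matrix is \<open>Y \<omega> ** X 1 0\<close> because \<open>Y\<close> is the identity at the origin; it lies in the
  group as a product of two of its elements.\<close>

lemma fixed_group_normal_form:
  fixes \<omega> :: "real^'d" and X :: "int \<Rightarrow> real^'d \<Rightarrow> complex^'n^'n"
  assumes ri: "rationally_independent \<omega>"
    and \<rho>: "resonance_index \<omega> \<rho>"
    and \<rho>N: "\<And>z. real N *\<^sub>R \<rho> z \<in> integer_vectors"
    and T: "\<forall>\<tau>\<in>T. gauge_compatible \<rho> \<tau>"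
    and X: "\<And>\<theta>. X 1 \<theta> \<in> fixed_group T" and red: "reducible \<omega> GL_complex X"
  obtains Y :: "real^'d \<Rightarrow> complex^'n^'n" and B where "continuous_on UNIV Y" "torus_periodic N Y" "\<forall>\<theta>. Y \<theta> \<in> fixed_group T" "Y 0 = mat 1"
    "B \<in> fixed_group T" "\<forall>\<theta>. Y (\<theta> + \<omega>) ** X 1 \<theta> = B ** Y \<theta>"
proof -
  obtain Z :: "real^'d \<Rightarrow> complex^'n^'n" and A
    where Z: "continuous_on UNIV Z" "torus_periodic 1 Z" "\<And>\<theta>. invertible (Z \<theta>)" "invertible A"
    "\<And>\<theta>. Z (\<theta> + \<omega>) ** X 1 \<theta> = A ** Z \<theta>"
    by (rule reducible_mod_generator[OF red]) blast
  have Xi: "invertible (X 1 \<theta>)" and X\<tau>: "\<tau> \<in> T \<Longrightarrow> \<tau> (X 1 \<theta>) = X 1 \<theta>" for \<theta> \<tau>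
    using X by (auto simp: fixed_group_def)
  obtain Y :: "real^'d \<Rightarrow> complex^'n^'n" and B where Y: "continuous_on UNIV Y" "torus_periodic N Y" "\<forall>\<theta>. invertible (Y \<theta>)" "Y 0 = mat 1"
    "\<forall>\<theta>. Y (\<theta> + \<omega>) ** X 1 \<theta> = B ** Y \<theta>"
    "\<forall>\<tau>. gauge_compatible \<rho> \<tau> \<longrightarrow> (\<forall>\<theta>. \<tau> (X 1 \<theta>) = X 1 \<theta>) \<longrightarrow> (\<forall>\<theta>. \<tau> (Y \<theta>) = Y \<theta>)"
    by (rule gauge_normal_form[OF ri \<rho> \<rho>N Z(1-4) Xi Z(5)]) (rule that)
  have YT: "\<tau> (Y \<theta>) = Y \<theta>" if "\<tau> \<in> T" for \<tau> \<theta>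
    using Y(6) T X\<tau> that by blast
  have B: "B = Y \<omega> ** X 1 0" using Y(4) spec[OF Y(5), of 0] by simp
  have "B \<in> fixed_group T"
    unfolding fixed_group_def
  proof (intro CollectI conjI ballI)
    show "invertible B" by (simp add: B invertible_mult Y Xi)
    fix \<tau> assume "\<tau> \<in> T"
    moreover from T this have "\<tau> B = \<tau> (Y \<omega>) ** \<tau> (X 1 0)"
      by (simp add: B gauge_compatible_def Y Xi)
    ultimately show "\<tau> B = B" by (simp add: YT X\<tau> B)
  qed
  moreover have "Y \<theta> \<in> fixed_group T" for \<theta> using Y(3) YT by (simp add: fixed_group_def)
  ultimately show ?thesis using that Y by blast
qed

lemma reducible_mod_fixed_group:
  fixes \<omega> :: "real^'d" and X :: "int \<Rightarrow> real^'d \<Rightarrow> complex^'n^'n"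
  assumes ri: "rationally_independent \<omega>"
    and \<rho>: "resonance_index \<omega> \<rho>"
    and \<rho>N: "\<And>z. real N *\<^sub>R \<rho> z \<in> integer_vectors"
    and T: "\<forall>\<tau>\<in>T. gauge_compatible \<rho> \<tau>"
    and X: "discrete_cocycle \<omega> (fixed_group T) X" and red: "reducible \<omega> GL_complex X"
  shows "reducible_mod N \<omega> (fixed_group T) X"
proof -
  have X1: "X 1 \<theta> \<in> fixed_group T" for \<theta> using X by (simp add: discrete_cocycle_def)
  obtain Y :: "real^'d \<Rightarrow> complex^'n^'n" and B
    where Y: "continuous_on UNIV Y" "torus_periodic N Y" "\<forall>\<theta>. Y \<theta> \<in> fixed_group T" "Y 0 = mat 1"
      "B \<in> fixed_group T" "\<forall>\<theta>. Y (\<theta> + \<omega>) ** X 1 \<theta> = B ** Y \<theta>"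
    by (rule fixed_group_normal_form[OF ri \<rho> \<rho>N T X1 red]) (rule that)
  show ?thesis
    by (rule reducible_mod_of_conjugacy[OF X _ Y(1,2) spec[OF Y(3)] Y(5) spec[OF Y(6)]]) (simp add: fixed_group_def)
qed

section \<open>The classical groups\<close>

lemma matrix_cnj_fixed_iff: "matrix_cnj M = M \<longleftrightarrow> (\<exists>R. M = complexify R)"
proof
  assume M: "matrix_cnj M = M"
  have "cnj (M $ i $ j) = M $ i $ j" for i j
    using arg_cong[OF M, of "\<lambda>M. M $ i $ j"] by (simp add: matrix_cnj_def)
  then have "M = complexify (map_matrix Re M)"
    by (simp add: vec_eq_iff complex_eq_iff)
  then show "\<exists>R. M = complexify R" by (rule exI)
next
  assume "\<exists>R. M = complexify R"
  then show "matrix_cnj M = M" by (auto simp: matrix_cnj_def vec_eq_iff)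
qed

lemma complexify_mult: "complexify (M ** N) = complexify M ** complexify N"
  by (simp add: vec_eq_iff matrix_matrix_mult_def)

lemma complexify_mat: "complexify (mat 1) = mat 1"
  by (simp add: vec_eq_iff mat_def)

lemma complexify_transpose: "complexify (transpose M) = transpose (complexify M)"
  by (simp add: vec_eq_iff transpose_def)

lemma complexify_eq_iff: "complexify M = complexify N \<longleftrightarrow> M = N"
  by (simp add: vec_eq_iff)

lemma det_complexify: "det (complexify M) = of_real (det M)"
  by (simp add: det_def)

lemma invertible_complexify: "invertible (complexify M) \<longleftrightarrow> invertible M"
  by (simp add: invertible_det_nz det_complexify)

lemma form_dual_fixed_iff:
  assumes "invertible F"
  shows "invertible M \<and> form_dual F M = M \<longleftrightarrow> transpose M ** F ** M = F"
proof
  assume M: "invertible M \<and> form_dual F M = M"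
  then have "F ** M = F ** (matrix_inv F ** (transpose (matrix_inv M) ** F))"
    by (simp add: form_dual_def)
  then have "F ** M = transpose (matrix_inv M) ** F"
    by (simp add: matrix_inv_cancel assms)
  then have "transpose M ** (F ** M) = transpose M ** transpose (matrix_inv M) ** F"
    by (simp add: matrix_mul_assoc)
  then show "transpose M ** F ** M = F"
    using M by (simp add: matrix_mul_assoc matrix_inv_left flip: matrix_transpose_mul)
next
  assume M: "transpose M ** F ** M = F"
  then have "(matrix_inv F ** (transpose M ** F)) ** M = mat 1"
    by (simp add: matrix_inv_left assms flip: matrix_mul_assoc)
  then have inv: "invertible M" using invertible_left_inverse by blast
  have "transpose (matrix_inv M) ** (transpose M ** F ** M) = F ** M"
    using inv by (simp add: matrix_mul_assoc matrix_inv_right flip: matrix_transpose_mul)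
  then have "form_dual F M = matrix_inv F ** (F ** M)" by (simp add: form_dual_def M)
  then show "invertible M \<and> form_dual F M = M" using inv assms by (simp add: matrix_inv_cancel)
qed

lemma GL_real_eq: "GL_real = fixed_group {matrix_cnj}"
  by (auto simp: GL_real_def fixed_group_def matrix_cnj_fixed_iff invertible_complexify)

lemma SL_real_eq: "SL_real = {M \<in> fixed_group {matrix_cnj}. det M = 1}"
  by (auto simp: SL_real_def fixed_group_def matrix_cnj_fixed_iff invertible_complexify det_complexify
      invertible_det_nz)

text \<open>This covers the orthogonal and the symplectic group: the real matrices among the isometries of a
  nondegenerate form.\<close>

lemma real_form_group_eq:
  assumes "invertible F"
  shows "complexify ` {M. transpose M ** F ** M = F} = fixed_group {matrix_cnj, form_dual (complexify F)}"
proof -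
  have iff: "transpose R ** F ** R = F \<longleftrightarrow>
      invertible (complexify R) \<and> form_dual (complexify F) (complexify R) = complexify R" for R
    using form_dual_fixed_iff[of "complexify F" "complexify R"] assms
    by (simp add: invertible_complexify complexify_eq_iff flip: complexify_mult complexify_transpose)
  show ?thesis
    by (auto simp: fixed_group_def matrix_cnj_fixed_iff iff)
qed

lemma O_real_eq: "O_real = fixed_group {matrix_cnj, form_dual (mat 1)}"
  using real_form_group_eq[OF invertible_mat_1]
  by (simp add: O_real_def orthogonal_matrix complexify_mat)

lemma sum_UNIV_sum: "sum f (UNIV :: ('a::finite + 'b::finite) set) = (\<Sum>a\<in>UNIV. f (Inl a)) + (\<Sum>b\<in>UNIV. f (Inr b))"
  unfolding UNIV_Plus_UNIV[symmetric] by (subst sum.Plus) (simp_all add: comp_def)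

lemma invertible_J_symp: "invertible (J_symp :: real^('m::finite + 'm)^('m + 'm))"
proof -
  have "(J_symp ** transpose J_symp :: real^('m + 'm)^('m + 'm)) $ i $ j = mat 1 $ i $ j" for i j
    by (cases i; cases j)
      (simp_all add: matrix_matrix_mult_def transpose_def J_symp_def mat_def sum_UNIV_sum
        if_distrib[of "\<lambda>x. x * _"] if_distrib[of "\<lambda>x. _ * x"] if_distrib[of uminus] cong: if_cong)
  then have "J_symp ** transpose J_symp = (mat 1 :: real^('m + 'm)^('m + 'm))" by (simp add: vec_eq_iff)
  then show ?thesis using invertible_right_inverse by blast
qed

lemma Sp_real_eq: "Sp_real = fixed_group {matrix_cnj, form_dual (complexify J_symp)}"
  unfolding Sp_real_def by (rule real_form_group_eq[OF invertible_J_symp])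

lemma U_complex_eq: "U_complex = fixed_group {\<lambda>M. matrix_cnj (form_dual (mat 1) M)}"
proof -
  have one: "matrix_inv (mat 1) = (mat 1 :: complex^'n^'n)" by (rule matrix_inv_unique) simp_all
  have "matrix_cnj (transpose M) ** M = mat 1 \<longleftrightarrow>
      invertible M \<and> matrix_cnj (transpose (matrix_inv M)) = M" for M :: "complex^'n^'n"
  proof -
    have id: "matrix_cnj (transpose M) ** matrix_cnj (transpose (matrix_inv M)) = mat 1" if "invertible M"
      using that by (simp add: matrix_inv_left matrix_cnj_mat flip: matrix_cnj_mult matrix_transpose_mul)
    show ?thesis
    proof
      assume M: "matrix_cnj (transpose M) ** M = mat 1"
      then have inv: "invertible M" using invertible_left_inverse by blast
      then have "invertible (matrix_cnj (transpose M))"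
        by (intro invertible_matrix_cnj invertible_transpose_iff)
      then show "invertible M \<and> matrix_cnj (transpose (matrix_inv M)) = M"
        using invertible_mult_left_cancel[of "matrix_cnj (transpose M)" _ M] id[OF inv] M inv by metis
    next
      assume M: "invertible M \<and> matrix_cnj (transpose (matrix_inv M)) = M"
      then show "matrix_cnj (transpose M) ** M = mat 1" using id by metis
    qed
  qed
  then show ?thesis
    by (auto simp: U_complex_def fixed_group_def form_dual_def one matrix_cnj_def)
qed

theorem theorem3:
  fixes \<omega> :: "real^'d"
  assumes "rationally_independent \<omega>"
  shows
    "(\<forall>G \<in> {GL_real, SL_real, O_real}. \<forall>X :: int \<Rightarrow> real^'d \<Rightarrow> complex^'n^'n.
        discrete_cocycle \<omega> G X \<and> reducible \<omega> GL_complex X \<longrightarrow> reducible_mod 2 \<omega> G X) \<and>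
     (\<forall>X :: int \<Rightarrow> real^'d \<Rightarrow> complex^('m::finite + 'm)^('m + 'm).
        discrete_cocycle \<omega> Sp_real X \<and> reducible \<omega> GL_complex X \<longrightarrow> reducible_mod 2 \<omega> Sp_real X) \<and>
     (\<forall>X :: int \<Rightarrow> real^'d \<Rightarrow> complex^'n^'n.
        discrete_cocycle \<omega> U_complex X \<and> reducible \<omega> GL_complex X \<longrightarrow> reducible_mod 1 \<omega> U_complex X)"
proof -
  obtain \<rho> :: "complex \<Rightarrow> real^'d" where
    \<rho>: "resonance_index \<omega> \<rho>"
      "\<And>z. real 2 *\<^sub>R \<rho> z \<in> integer_vectors"
    and \<rho>_sym: "\<And>z. \<rho> (cnj z) = - \<rho> z" "\<And>z. z \<noteq> 0 \<Longrightarrow> \<rho> (inverse z) = - \<rho> z"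
    using ex_half_resonance_index[OF assms] by metis
  note fixed = reducible_mod_fixed_group[OF assms \<rho>]
  note compat = gauge_compatible_cnj[of \<rho>, OF \<rho>_sym(1)] gauge_compatible_form_dual[of \<rho>, OF \<rho>_sym(2)]
  have GL: "reducible_mod 2 \<omega> GL_real X"
    if "discrete_cocycle \<omega> GL_real X" "reducible \<omega> GL_complex X" for X :: "int \<Rightarrow> real^'d \<Rightarrow> complex^'n^'n"
    using that unfolding GL_real_eq by (intro fixed) (auto simp: compat)
  have O: "reducible_mod 2 \<omega> O_real X"
    if "discrete_cocycle \<omega> O_real X" "reducible \<omega> GL_complex X" for X :: "int \<Rightarrow> real^'d \<Rightarrow> complex^'n^'n"
    using that unfolding O_real_eq by (intro fixed) (auto simp: compat invertible_mat_1)
  have Sp: "reducible_mod 2 \<omega> Sp_real X"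
    if "discrete_cocycle \<omega> Sp_real X" "reducible \<omega> GL_complex X"
    for X :: "int \<Rightarrow> real^'d \<Rightarrow> complex^('m + 'm)^('m + 'm)"
    using that unfolding Sp_real_eq
    by (intro fixed) (auto simp: compat invertible_complexify invertible_J_symp)
  have SL: "reducible_mod 2 \<omega> SL_real X"
    if X: "discrete_cocycle \<omega> SL_real X" and red: "reducible \<omega> GL_complex X"
    for X :: "int \<Rightarrow> real^'d \<Rightarrow> complex^'n^'n"
  proof -
    have X1: "X 1 \<theta> \<in> fixed_group {matrix_cnj}" "det (X 1 \<theta>) = 1" for \<theta>
      using X by (auto simp: discrete_cocycle_def SL_real_eq)
    have T: "\<forall>\<tau>\<in>{matrix_cnj :: complex^'n^'n \<Rightarrow> _}. gauge_compatible \<rho> \<tau>" by (simp add: compat)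
    obtain Y :: "real^'d \<Rightarrow> complex^'n^'n" and B where Y: "continuous_on UNIV Y" "torus_periodic 2 Y" "\<forall>\<theta>. Y \<theta> \<in> fixed_group {matrix_cnj}"
      "Y 0 = mat 1" "B \<in> fixed_group {matrix_cnj}" "\<forall>\<theta>. Y (\<theta> + \<omega>) ** X 1 \<theta> = B ** Y \<theta>"
      by (rule fixed_group_normal_form[OF assms \<rho> T X1(1) red]) (rule that)
    \<comment> \<open>What \<open>Y\<close> still lacks for being special linear is determinant 1.\<close>
    have det_Y: "det (Y (\<theta> + \<omega>)) = det B * det (Y \<theta>)" for \<theta>
      using arg_cong[OF spec[OF Y(6), of \<theta>], of det] by (simp add: det_mul X1)
    have det1: "det (Y \<theta>) = 1" for \<theta>
    proof (rule real_shift_eigenfunction_constant[OF assms, where c = "det B"])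
      show "continuous_on UNIV (\<lambda>\<theta>. det (Y \<theta>))" by (intro continuous_intros Y)
      show "torus_periodic 2 (\<lambda>\<theta>. det (Y \<theta>))" using Y(2) by (simp add: torus_periodic_def)
      show "det (Y \<theta>) \<in> \<real>" for \<theta>
        using spec[OF Y(3), of \<theta>] by (auto simp: fixed_group_def matrix_cnj_fixed_iff det_complexify)
    qed (simp_all add: det_Y Y(4))
    then have "det B = 1" using det_Y[of 0] by simp
    then have "B \<in> SL_real" "Y \<theta> \<in> SL_real" for \<theta>
      using Y(3,5) det1 by (auto simp: SL_real_eq)
    then show ?thesis
      by (intro reducible_mod_of_conjugacy[OF X _ Y(1,2) _ _ spec[OF Y(6)]])
        (auto simp: SL_real_eq fixed_group_def)
  qed
  obtain \<kappa> :: "complex \<Rightarrow> real^'d" where int: "\<And>a. \<kappa> a \<in> integer_vectors"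
    and \<kappa>: "resonance_index \<omega> \<kappa>"
    and pos: "\<And>a t. t > 0 \<Longrightarrow> \<kappa> (of_real t * a) = \<kappa> a"
    using ex_resonance_index[OF assms] by metis
  have \<kappa>_inv: "\<kappa> (inverse (cnj z)) = \<kappa> z" if "z \<noteq> 0" for z
    using that pos[of "inverse ((norm z)\<^sup>2)" z] inverse_eq_scaled_cnj[of "cnj z"] by simp
  have U: "reducible_mod 1 \<omega> U_complex X"
    if "discrete_cocycle \<omega> U_complex X" "reducible \<omega> GL_complex X" for X :: "int \<Rightarrow> real^'d \<Rightarrow> complex^'n^'n"
    using that unfolding U_complex_eq
    by (intro reducible_mod_fixed_group[OF assms \<kappa>]) (auto simp: int gauge_compatible_unitary[of \<kappa>, OF \<kappa>_inv])
  show ?thesis using GL SL O Sp U by blast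
qed

end
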